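(* Let $T(n,\varepsilon)$ be a function and assume there is an oracle which, given a complete digraph $G=(V,E,w)$ on $n$ vertices with weights in $\{-1,0,1\}$ and no negative-weight cycles and given $\varepsilon>0$, computes in time $T(n,\varepsilon)$ a vector $p\in\mathbb{R}^n$ that is $\varepsilon$-suboptimal for the dual LP $\max_{p\in\mathbb{R}^n}\min_{(i,j)\in E}\big(w(i,j)+p_i-p_j\big)$, i.e. $\min_{(i,j)\in E}(w(i,j)+p_i-p_j)\ge \mu(G)-\varepsilon$. Then for any such $G$ and any source vertex $s\in V$, the Single Source Shortest Paths problem on $G$ from $s$ can be solved in time $T(n,\varepsilon)+O(n^3\varepsilon\log n+n^2\log n)$.
   Context: $\mu(G)$ denotes the minimum, over directed cycles $\sigma$ of $G$, of the mean weight $\frac{1}{|\sigma|}\sum_{e\in\sigma}w(e)$; it equals the optimal value of the stated dual LP. Single Source Shortest Paths from $s$ asks for the $w$-weighted shortest-path distances from $s$ to all vertices (equivalently a shortest path tree rooted at $s$). *)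

theory Defs
  imports Complex_Main "Graph_Theory.Shortest_Path" "Graph_Theory.Pair_Digraph"
    "Graph_Theory.Kuratowski"
begin

section \<open>Weighted complete digraphs, minimum cycle mean, dual LP\<close>

definition complete_on :: "nat \<Rightarrow> nat pair_pre_digraph" where
  "complete_on n = \<lparr> pverts = {..<n}, parcs = {(i, j). i < n \<and> j < n \<and> i \<noteq> j} \<rparr>"

lemma complete_digraph_complete_on: "K\<^bsub>n\<^esub> (with_proj (complete_on n))"
proof -
  have "finite (parcs (complete_on n))"
    by (rule finite_subset[of _ "{..<n} \<times> {..<n}"]) (auto simp: complete_on_def)
  then have "pair_graph (complete_on n)"
    by unfold_locales
      (auto simp: complete_on_def symmetric_def arcs_ends_conv intro!: symI)
  then interpret pair_graph "complete_on n" .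
  have "graph (with_proj (complete_on n))"
    by unfold_locales (rule sym_arcs)
  then show ?thesis
    unfolding complete_digraph_def
    by (auto simp: complete_on_def)
qed

text \<open>
  A cycle is the library's \<^const>\<open>pre_digraph.cycle\<close>: a nonempty closed walk, given by its list of
  arcs, that repeats no vertex. The weights are real-valued functions on arcs, as in the library,
  restricted to the three values.
\<close>

definition admissible :: "nat \<Rightarrow> (nat \<times> nat) weight_fun \<Rightarrow> bool" where
  "admissible n w \<longleftrightarrow>
     (\<forall>e \<in> parcs (complete_on n). w e \<in> {-1, 0, 1}) \<and>
     (\<forall>c. pre_digraph.cycle (with_proj (complete_on n)) c \<longrightarrow> 0 \<le> wf_digraph.awalk_cost w c)"

definition min_cycle_mean :: "nat \<Rightarrow> (nat \<times> nat) weight_fun \<Rightarrow> real" where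
  "min_cycle_mean n w =
     Min {wf_digraph.awalk_cost w c / real (length c) |c.
            pre_digraph.cycle (with_proj (complete_on n)) c}"

text \<open>A vector in \<open>\<real>\<^sup>n\<close> is a function on \<^typ>\<open>nat\<close>, only its values below \<open>n\<close> are ever used.\<close>

definition dual_objective :: "nat \<Rightarrow> (nat \<times> nat) weight_fun \<Rightarrow> (nat \<Rightarrow> real) \<Rightarrow> real" where
  "dual_objective n w p = Min ((\<lambda>(i, j). w (i, j) + p i - p j) ` parcs (complete_on n))"

definition suboptimal :: "nat \<Rightarrow> (nat \<times> nat) weight_fun \<Rightarrow> real \<Rightarrow> (nat \<Rightarrow> real) \<Rightarrow> bool" where
  "suboptimal n w \<epsilon> p \<longleftrightarrow> dual_objective n w p \<ge> min_cycle_mean n w - \<epsilon>"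


section \<open>Real RAM with an oracle instruction\<close>

text \<open>
  Programs work on finitely many named arrays of natural numbers (used for indices, pointers and
  flags) and of real numbers. A scalar variable is cell 0 of an array. The only arithmetic is
  addition and subtraction (truncated on \<^typ>\<open>nat\<close>) and comparison; there is neither multiplication
  nor rounding nor any conversion from reals to naturals, and real constants are integers. This avoids
  the known ways of abusing unit-cost arithmetic on large or infinitely precise numbers.
\<close>

type_synonym vname = string

record store =
  nats :: "vname \<Rightarrow> nat \<Rightarrow> nat"
  reals :: "vname \<Rightarrow> nat \<Rightarrow> real"

datatype nexp = NConst nat | NArr vname nexp | NAdd nexp nexp | NSub nexp nexp

datatype rexp = RConst int | RArr vname nexp | RAdd rexp rexp | RSub rexp rexp

datatype bexp = NLess nexp nexp | RLess rexp rexp | BNot bexp | BAnd bexp bexp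

datatype com =
    Skip
  | NAssign vname nexp nexp
  | RAssign vname nexp rexp
  | Seq com com
  | If bexp com com
  | While bexp com
  | CallOracle vname nexp vname rexp
    \<comment> \<open>\<open>CallOracle P m W e\<close>: \<open>P := oracle(m, W, e)\<close>, with \<open>W\<close> an \<open>m \<times> m\<close> matrix in row-major order\<close>

primrec nval :: "nexp \<Rightarrow> store \<Rightarrow> nat" where
  "nval (NConst k) \<sigma> = k"
| "nval (NArr x a) \<sigma> = nats \<sigma> x (nval a \<sigma>)"
| "nval (NAdd a b) \<sigma> = nval a \<sigma> + nval b \<sigma>"
| "nval (NSub a b) \<sigma> = nval a \<sigma> - nval b \<sigma>"

primrec rval :: "rexp \<Rightarrow> store \<Rightarrow> real" where
  "rval (RConst k) \<sigma> = of_int k"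
| "rval (RArr x a) \<sigma> = reals \<sigma> x (nval a \<sigma>)"
| "rval (RAdd a b) \<sigma> = rval a \<sigma> + rval b \<sigma>"
| "rval (RSub a b) \<sigma> = rval a \<sigma> - rval b \<sigma>"

primrec bval :: "bexp \<Rightarrow> store \<Rightarrow> bool" where
  "bval (NLess a b) \<sigma> \<longleftrightarrow> nval a \<sigma> < nval b \<sigma>"
| "bval (RLess a b) \<sigma> \<longleftrightarrow> rval a \<sigma> < rval b \<sigma>"
| "bval (BNot b) \<sigma> \<longleftrightarrow> \<not> bval b \<sigma>"
| "bval (BAnd b c) \<sigma> \<longleftrightarrow> bval b \<sigma> \<and> bval c \<sigma>"

primrec ncost :: "nexp \<Rightarrow> nat" where
  "ncost (NConst k) = 1"
| "ncost (NArr x a) = 1 + ncost a"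
| "ncost (NAdd a b) = 1 + ncost a + ncost b"
| "ncost (NSub a b) = 1 + ncost a + ncost b"

primrec rcost :: "rexp \<Rightarrow> nat" where
  "rcost (RConst k) = 1"
| "rcost (RArr x a) = 1 + ncost a"
| "rcost (RAdd a b) = 1 + rcost a + rcost b"
| "rcost (RSub a b) = 1 + rcost a + rcost b"

primrec bcost :: "bexp \<Rightarrow> nat" where
  "bcost (NLess a b) = 1 + ncost a + ncost b"
| "bcost (RLess a b) = 1 + rcost a + rcost b"
| "bcost (BNot b) = 1 + bcost b"
| "bcost (BAnd b c) = 1 + bcost b + bcost c"

definition set_nat :: "vname \<Rightarrow> nat \<Rightarrow> nat \<Rightarrow> store \<Rightarrow> store" where
  "set_nat x i k \<sigma> = \<sigma>\<lparr>nats := (nats \<sigma>)(x := (nats \<sigma> x)(i := k))\<rparr>"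

definition set_real :: "vname \<Rightarrow> nat \<Rightarrow> real \<Rightarrow> store \<Rightarrow> store" where
  "set_real x i r \<sigma> = \<sigma>\<lparr>reals := (reals \<sigma>)(x := (reals \<sigma> x)(i := r))\<rparr>"

definition set_vector :: "vname \<Rightarrow> nat \<Rightarrow> (nat \<Rightarrow> real) \<Rightarrow> store \<Rightarrow> store" where
  "set_vector x n p \<sigma> =
     \<sigma>\<lparr>reals := (reals \<sigma>)(x := (\<lambda>i. if i < n then p i else reals \<sigma> x i))\<rparr>"

definition weight_of_matrix :: "nat \<Rightarrow> (nat \<Rightarrow> real) \<Rightarrow> (nat \<times> nat) weight_fun" where
  "weight_of_matrix n a =
     (\<lambda>(i, j). if (i, j) \<in> parcs (complete_on n) then a (i * n + j) else 0)"

definition matrix_of_weight :: "nat \<Rightarrow> (nat \<times> nat) weight_fun \<Rightarrow> nat \<Rightarrow> real" where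
  "matrix_of_weight n w =
     (\<lambda>k. if (k div n, k mod n) \<in> parcs (complete_on n) then w (k div n, k mod n) else 0)"

type_synonym dual_oracle_fun = "nat \<Rightarrow> (nat \<times> nat) weight_fun \<Rightarrow> real \<Rightarrow> nat \<Rightarrow> real"

text \<open>
  \<open>exec T orc c \<sigma> t \<sigma>'\<close>: started in \<open>\<sigma>\<close>, the program \<open>c\<close> terminates in \<open>\<sigma>'\<close> after time \<open>t\<close>. A call of
  the oracle on an \<open>m\<close>-vertex graph with accuracy \<open>e\<close> takes time \<open>T m e\<close>, in addition to the time for
  evaluating the arguments.
\<close>

inductive exec ::
  "(nat \<Rightarrow> real \<Rightarrow> real) \<Rightarrow> dual_oracle_fun \<Rightarrow> com \<Rightarrow> store \<Rightarrow> real \<Rightarrow> store \<Rightarrow> bool"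
  for T :: "nat \<Rightarrow> real \<Rightarrow> real" and orc :: dual_oracle_fun where
  Skip: "exec T orc Skip \<sigma> 1 \<sigma>"
| NAssign: "exec T orc (NAssign x a b) \<sigma> (real (1 + ncost a + ncost b))
    (set_nat x (nval a \<sigma>) (nval b \<sigma>) \<sigma>)"
| RAssign: "exec T orc (RAssign x a r) \<sigma> (real (1 + ncost a + rcost r))
    (set_real x (nval a \<sigma>) (rval r \<sigma>) \<sigma>)"
| Seq: "exec T orc c \<sigma> t \<sigma>' \<Longrightarrow> exec T orc d \<sigma>' u \<sigma>'' \<Longrightarrow>
    exec T orc (Seq c d) \<sigma> (t + u) \<sigma>''"
| IfTrue: "bval b \<sigma> \<Longrightarrow> exec T orc c \<sigma> t \<sigma>' \<Longrightarrow>
    exec T orc (If b c d) \<sigma> (real (1 + bcost b) + t) \<sigma>'"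
| IfFalse: "\<not> bval b \<sigma> \<Longrightarrow> exec T orc d \<sigma> t \<sigma>' \<Longrightarrow>
    exec T orc (If b c d) \<sigma> (real (1 + bcost b) + t) \<sigma>'"
| WhileFalse: "\<not> bval b \<sigma> \<Longrightarrow>
    exec T orc (While b c) \<sigma> (real (1 + bcost b)) \<sigma>"
| WhileTrue: "bval b \<sigma> \<Longrightarrow> exec T orc c \<sigma> t \<sigma>' \<Longrightarrow> exec T orc (While b c) \<sigma>' u \<sigma>'' \<Longrightarrow>
    exec T orc (While b c) \<sigma> (real (1 + bcost b) + t + u) \<sigma>''"
| CallOracle: "m = nval a \<sigma> \<Longrightarrow> e = rval r \<sigma> \<Longrightarrow>
    exec T orc (CallOracle p a x r) \<sigma> (real (1 + ncost a + rcost r) + T m e)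
      (set_vector p m (orc m (weight_of_matrix m (reals \<sigma> x)) e) \<sigma>)"

lemma exec_deterministic:
  "exec T orc c \<sigma> t \<sigma>' \<Longrightarrow> exec T orc c \<sigma> u \<sigma>'' \<Longrightarrow> u = t \<and> \<sigma>'' = \<sigma>'"
proof (induction arbitrary: u \<sigma>'' rule: exec.induct)
  case (Seq c \<sigma> t \<sigma>' d v \<tau>)
  from Seq.prems show ?case by cases (use Seq.IH in blast)
next
  case (WhileTrue b \<sigma> c t \<sigma>' v \<tau>)
  from WhileTrue.prems show ?case by cases (use WhileTrue in blast)+
qed (erule exec.cases; force)+

text \<open>
  The oracle assumption. It is empty for \<open>n < 2\<close>, where the complete digraph has no arcs and no
  cycles, and nothing is assumed about the answers to inadmissible queries.
\<close>

definition dual_oracle :: "(nat \<Rightarrow> real \<Rightarrow> real) \<Rightarrow> dual_oracle_fun \<Rightarrow> bool" where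
  "dual_oracle T orc \<longleftrightarrow>
     (\<forall>n \<epsilon>. 0 \<le> T n \<epsilon>) \<and>
     (\<forall>n w \<epsilon>. 2 \<le> n \<and> admissible n w \<and> 0 < \<epsilon> \<longrightarrow> suboptimal n w \<epsilon> (orc n w \<epsilon>))"

definition input_store :: "nat \<Rightarrow> (nat \<times> nat) weight_fun \<Rightarrow> nat \<Rightarrow> real \<Rightarrow> store" where
  "input_store n w s \<epsilon> =
     \<lparr>nats = (\<lambda>_ _. 0)(''n'' := (\<lambda>_. 0)(0 := n), ''s'' := (\<lambda>_. 0)(0 := s)),
      reals = (\<lambda>_ _. 0)(''W'' := matrix_of_weight n w, ''eps'' := (\<lambda>_. 0)(0 := \<epsilon>))\<rparr>"

definition outputs_distances :: "nat \<Rightarrow> (nat \<times> nat) weight_fun \<Rightarrow> nat \<Rightarrow> store \<Rightarrow> bool" where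
  "outputs_distances n w s \<sigma> \<longleftrightarrow>
     (\<forall>v < n. ereal (reals \<sigma> ''D'' v) = wf_digraph.\<mu> (with_proj (complete_on n)) w s v)"

end

theory Submission
  imports Defs "Graph_Theory.Euler"
begin

text \<open>
  Since \<open>\<mu>(G) \<ge> 0\<close>, the oracle's potential gives \<open>w(i,j) + p\<^sub>i - p\<^sub>j + \<epsilon> \<ge> 0\<close> on every arc, so Dijkstra's
  algorithm applies to these lengths. Starting it from keys \<open>D(v) - p\<^sub>v\<close>, where \<open>D\<close> is a vector of
  labels attained by walks, each arc costs an error of at most \<open>\<epsilon>\<close>. As the costs are integers, a run
  is exact along extensions by \<open>H\<close> arcs whenever \<open>H \<epsilon> < 1\<close>: if \<open>D(v)\<close> is at most the cost of all
  walks to \<open>v\<close> with at most \<open>k\<close> arcs, then afterwards the same holds for \<open>k + H\<close>. Relaxing \<open>D\<close> itself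
  along all arcs in the same run covers \<open>H = 1\<close> for large \<open>\<epsilon>\<close>. Hence \<open>O(n \<epsilon> + 1)\<close> runs of the quadratic-time
  Dijkstra algorithm suffice.
\<close>

section \<open>Walks in the complete digraph\<close>

abbreviation KD :: "nat \<Rightarrow> (nat, nat \<times> nat) pre_digraph" where
  "KD n \<equiv> with_proj (complete_on n)"

abbreviation walk :: "nat \<Rightarrow> nat \<Rightarrow> (nat \<times> nat) list \<Rightarrow> nat \<Rightarrow> bool" where
  "walk n \<equiv> pre_digraph.awalk (KD n)"

abbreviation cost :: "(nat \<times> nat) weight_fun \<Rightarrow> (nat \<times> nat) list \<Rightarrow> real" where
  "cost \<equiv> wf_digraph.awalk_cost"

lemma fin_digraph_KD: "fin_digraph (KD n)"
proof -
  interpret graph "KD n"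
    using complete_digraph_complete_on by (auto simp: complete_digraph_def)
  show ?thesis by unfold_locales
qed

lemma wf_digraph_KD: "wf_digraph (KD n)"
  using fin_digraph_KD by (simp add: fin_digraph_def)

lemma pverts_complete_on [simp]: "pverts (complete_on n) = {..<n}"
  and verts_KD: "verts (KD n) = {..<n}"
  and parcs_complete_on [simp]: "parcs (complete_on n) = {(i, j). i < n \<and> j < n \<and> i \<noteq> j}"
  by (simp_all add: complete_on_def)

lemma cost_Nil [simp]: "cost w [] = 0"
  and cost_Cons [simp]: "cost w (e # q) = w e + cost w q"
  and cost_append [simp]: "cost w (q @ r) = cost w q + cost w r"
  using wf_digraph.awalk_cost_Nil[OF wf_digraph_KD] wf_digraph.awalk_cost_Cons[OF wf_digraph_KD]
    wf_digraph.awalk_cost_append[OF wf_digraph_KD] by auto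

lemma cost_cong: "(\<And>e. e \<in> set q \<Longrightarrow> w e = w' e) \<Longrightarrow> cost w q = cost w' q"
  by (induction q) auto

lemma walk_bound: "walk n s q v \<Longrightarrow> v < n"
  using wf_digraph.awalk_last_in_verts[OF wf_digraph_KD] by (fastforce simp: verts_KD)

lemma walk_Nil_iff: "walk n s [] v \<longleftrightarrow> s = v \<and> s < n"
  by (simp add: wf_digraph.awalk_Nil_iff[OF wf_digraph_KD])

text \<open>Arguments that add one hop at a time extend a walk at its far end, so its last arc is
  split off. Loops are not arcs of the complete digraph, whence the condition that the ends
  differ.\<close>

lemma walk_snoc_iff:
  "walk n s (q @ [e]) v \<longleftrightarrow>
     walk n s q (fst e) \<and> snd e = v \<and> fst e < n \<and> v < n \<and> fst e \<noteq> v"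
proof -
  interpret wf_digraph "KD n" by (rule wf_digraph_KD)
  show ?thesis
    using awlast_of_awalk[of s q "fst e"] awalk_last_in_verts[of s q "fst e"]
    by (cases e) (auto simp: awalk_simps)
qed

text \<open>Integrality is what turns an approximation error below 1 into no error at all.\<close>

lemma cost_Ints:
  assumes "admissible n w" "walk n s q v"
  shows "cost w q \<in> \<int>"
proof -
  have "set q \<subseteq> arcs (KD n)"
    using assms(2) by (auto simp: pre_digraph.awalk_def)
  then show ?thesis
  proof (induction q)
    case (Cons e q)
    then have "w e \<in> {-1, 0, 1}"
      using assms(1) by (auto simp: admissible_def)
    then have "w e \<in> \<int>" by auto
    then show ?case using Cons by auto
  qed simp
qed

text \<open>Admissibility speaks of cycles only. A closed walk that repeats an inner vertex splits
  into two shorter closed walks, so strong induction on the length reduces every closed walk to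
  cycles.\<close>

lemma closed_walk_cost_nonneg:
  assumes adm: "admissible n w" and "walk n u c u"
  shows "0 \<le> cost w c"
proof -
  interpret wf_digraph "KD n" by (rule wf_digraph_KD)
  show ?thesis
    using assms(2)
  proof (induction "length c" arbitrary: u c rule: less_induct)
    case less
    show ?case
    proof (cases c)
      case (Cons e c')
      show ?thesis
      proof (cases "distinct (tl (awalk_verts u c))")
        case True
        then have "cycle c" using less.prems Cons unfolding cycle_def by blast
        then show ?thesis using adm by (auto simp: admissible_def)
      next
        case False
        have e: "e \<in> arcs (KD n)" "u = tail (KD n) e" "awalk (head (KD n) e) c' u"
          using less.prems unfolding Cons awalk_Cons_iff by auto
        \<comment> \<open>Past the first vertex, the vertices of \<open>c\<close> are those of
          \<open>c'\<close>, so the repetition already occurs within \<open>c'\<close>.\<close>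
        have "\<not> distinct (awalk_verts (head (KD n) e) c')"
          using False Cons by simp
        from awalk_not_distinct_decomp[OF e(3) this] obtain q r t where
          qrt: "c' = q @ r @ t" "0 < length r" "\<exists>x. awalk (head (KD n) e) q x \<and> awalk x r x \<and> awalk x t u"
          by blast
        then obtain x where x: "awalk (head (KD n) e) q x" "awalk x r x" "awalk x t u" by blast
        \<comment> \<open>Cutting out the closed piece \<open>r\<close> leaves a closed walk; it is
          shorter as \<open>r\<close> is nonempty, and \<open>r\<close> is shorter than
          \<open>c\<close> as it misses \<open>e\<close>.\<close>
        have "awalk u (e # q @ t) u"
          using e(1,2) awalk_appendI[OF x(1,3)] by (simp only: awalk_Cons_iff simp_thms)
        with less.hyps[of r x] less.hyps[of "e # q @ t" u] x(2) show ?thesis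
          using Cons qrt by simp
      qed
    qed simp
  qed
qed

text \<open>Without negative closed walks the infimum over walks is reached by a path, and a path
  repeats no vertex, so it has fewer than \<open>n\<close> arcs. Reachability is immediate:
  completeness supplies the arc from \<open>s\<close> to \<open>v\<close>.\<close>

lemma distance_attained:
  assumes adm: "admissible n w" and "s < n" "v < n"
  obtains q where "walk n s q v" "length q < n" "wf_digraph.\<mu> (KD n) w s v = ereal (cost w q)"
proof -
  interpret fin_digraph "KD n" by (rule fin_digraph_KD)
  have "awalk s (if s = v then [] else [(s, v)]) v"
    using assms by (auto simp: awalk_simps)
  then have "s \<rightarrow>\<^sup>*\<^bsub>KD n\<^esub> v" by (rule reachable_awalkI)
  then obtain q where "apath s q v" "\<mu> w s v = awalk_cost w q"
    using no_neg_cyc_reach_imp_path[of s v w] closed_walk_cost_nonneg[OF adm]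
    by (meson not_le)
  moreover from this(1) have "length q < card (verts (KD n))"
    by (rule length_apath_less)
  ultimately show ?thesis using that by (auto simp: apath_def)
qed

lemma distance_le: "walk n s q v \<Longrightarrow> wf_digraph.\<mu> (KD n) w s v \<le> ereal (cost w q)"
  by (rule wf_digraph.min_cost_le_walk_cost[OF wf_digraph_KD])

section \<open>The minimum cycle mean and the slack of suboptimal potentials\<close>

lemma min_cycle_mean_nonneg:
  assumes adm: "admissible n w" and n: "2 \<le> n"
  shows "0 \<le> min_cycle_mean n w"
proof -
  interpret fin_digraph "KD n" by (rule fin_digraph_KD)
  let ?C = "{c. cycle c}"
  \<comment> \<open>\<open>Min\<close> is informative only on a finite nonempty set. Cycles are
    trails, of which a finite digraph has finitely many.\<close>
  have "?C \<subseteq> {p. \<exists>u v. trail u p v}"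
    by (auto simp: cycle_conv trail_def)
  then have "finite ?C"
    using trails_finite finite_subset by blast
  then have fin: "finite ((\<lambda>c. cost w c / real (length c)) ` ?C)" by simp
  \<comment> \<open>Two vertices suffice for a cycle: there and back again.\<close>
  have "awalk 0 [(0, 1), (1, 0)] 0"
    using n by (auto simp: awalk_simps)
  then have "cycle [(0, 1), (1, 0)]"
    by (auto simp: cycle_def)
  then have ne: "(\<lambda>c. cost w c / real (length c)) ` ?C \<noteq> {}" by blast
  have "0 \<le> Min ((\<lambda>c. cost w c / real (length c)) ` ?C)"
    using adm by (subst Min_ge_iff[OF fin ne]) (auto simp: admissible_def)
  also have "(\<lambda>c. cost w c / real (length c)) ` ?C =
      {cost w c / real (length c) |c. cycle c}" by auto
  finally show ?thesis by (simp add: min_cycle_mean_def)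
qed

text \<open>The dual objective is at least \<open>- \<epsilon>\<close> because the minimum cycle
  mean is nonnegative, and it bounds each reduced weight from below. Adding
  \<open>\<epsilon>\<close> to all of them therefore yields valid lengths for Dijkstra's
  algorithm.\<close>

lemma suboptimal_slack:
  assumes "admissible n w" "suboptimal n w \<epsilon> p" "i < n" "j < n" "i \<noteq> j"
  shows "- \<epsilon> \<le> w (i, j) + p i - p j"
proof -
  interpret fin_digraph "KD n" by (rule fin_digraph_KD)
  have "2 \<le> n" using assms(3-5) by linarith
  then have "- \<epsilon> \<le> dual_objective n w p"
    using min_cycle_mean_nonneg[OF assms(1)] assms(2) by (auto simp: suboptimal_def)
  also have "\<dots> \<le> (\<lambda>(i, j). w (i, j) + p i - p j) (i, j)"
    unfolding dual_objective_def
    using finite_arcs assms(3-5) by (intro Min_le finite_imageI imageI) auto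
  finally show ?thesis by simp
qed

text \<open>The oracle is queried with the weights decoded from the matrix, which agree with
  \<open>w\<close> on arcs but may differ elsewhere. Cycles see arcs only.\<close>

lemma admissible_cong:
  assumes "admissible n w" "\<And>i j. i < n \<Longrightarrow> j < n \<Longrightarrow> i \<noteq> j \<Longrightarrow> w' (i, j) = w (i, j)"
  shows "admissible n w'"
proof -
  have "cost w' c = cost w c" if "pre_digraph.cycle (KD n) c" for c
  proof (rule cost_cong)
    fix e assume "e \<in> set c"
    with that have "e \<in> arcs (KD n)"
      by (auto simp: pre_digraph.cycle_def pre_digraph.awalk_def)
    then show "w' e = w e" using assms(2) by (cases e) auto
  qed
  then show ?thesis using assms by (auto simp: admissible_def)
qed

lemma matrix_of_weight_entry:
  "j < n \<Longrightarrow> i < n \<Longrightarrow> matrix_of_weight n w (i * n + j) = (if i = j then 0 else w (i, j))"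
  by (simp add: matrix_of_weight_def)

lemma weight_of_matrix_of_weight:
  "i < n \<Longrightarrow> j < n \<Longrightarrow> i \<noteq> j \<Longrightarrow> weight_of_matrix n (matrix_of_weight n w) (i, j) = w (i, j)"
  by (simp add: weight_of_matrix_def matrix_of_weight_entry)


section \<open>One round of label improvement\<close>

text \<open>Soundness of labels: an attained label is never below the distance and is an integer
  when the weights are admissible.\<close>

definition attained :: "nat \<Rightarrow> (nat \<times> nat) weight_fun \<Rightarrow> nat \<Rightarrow> (nat \<Rightarrow> real) \<Rightarrow> bool" where
  "attained n w s D \<longleftrightarrow> (\<forall>v<n. \<exists>q. walk n s q v \<and> D v = cost w q)"

text \<open>Completeness of labels up to \<open>k\<close> hops, as in the Bellman-Ford
  algorithm.\<close>

definition covers :: "nat \<Rightarrow> (nat \<times> nat) weight_fun \<Rightarrow> nat \<Rightarrow> nat \<Rightarrow> (nat \<Rightarrow> real) \<Rightarrow> bool" where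
  "covers n w s k D \<longleftrightarrow> (\<forall>q v. walk n s q v \<and> length q \<le> k \<longrightarrow> D v \<le> cost w q)"

text \<open>Some shortest walk has fewer than \<open>n\<close> arcs, so covering \<open>n\<close>
  hops bounds the labels from above by the distances; attainment is the converse bound.\<close>

lemma distances_if_attained_covers:
  assumes "admissible n w" "s < n" "attained n w s D" "covers n w s k D" "n \<le> k" "v < n"
  shows "ereal (D v) = wf_digraph.\<mu> (KD n) w s v"
proof (rule antisym)
  obtain q where "walk n s q v" "length q < n" "wf_digraph.\<mu> (KD n) w s v = ereal (cost w q)"
    using distance_attained assms by blast
  then show "ereal (D v) \<le> wf_digraph.\<mu> (KD n) w s v"
    using assms by (auto simp: covers_def)
  show "wf_digraph.\<mu> (KD n) w s v \<le> ereal (D v)"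
    using assms(3,6) distance_le by (auto simp: attained_def)
qed

text \<open>A lowered label is witnessed by appending the arc \<open>(u, v)\<close> to the walk that
  witnesses the label of \<open>u\<close>.\<close>

lemma attained_relax:
  assumes "attained n w s D" "u < n"
    and "\<And>v. v < n \<Longrightarrow> D' v = D v \<or> D' v = D u + w (u, v) \<and> u \<noteq> v"
  shows "attained n w s D'"
  unfolding attained_def
proof (intro allI impI)
  fix v assume v: "v < n"
  show "\<exists>q. walk n s q v \<and> D' v = cost w q"
  proof (cases "D' v = D v")
    case True
    then show ?thesis using assms(1) v by (auto simp: attained_def)
  next
    case False
    then have D': "D' v = D u + w (u, v)" "u \<noteq> v" using assms(3)[OF v] by auto
    obtain q where "walk n s q u" "D u = cost w q"
      using assms(1,2) by (auto simp: attained_def)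
    then have "walk n s (q @ [(u, v)]) v \<and> D' v = cost w (q @ [(u, v)])"
      using D' v assms(2) walk_snoc_iff by simp
    then show ?thesis by blast
  qed
qed

text \<open>
  Along a walk with \<open>h\<close> further arcs, the potential \<open>K\<close> overshoots by at most \<open>h * \<epsilon>\<close>. Labels and walk
  costs are integers, so an overshoot below 1 is none at all.
\<close>

lemma covers_extend:
  assumes adm: "admissible n w" and "0 < \<epsilon>"
    and cov: "covers n w s k D0" and att: "attained n w s D"
    and K0: "\<And>x. x < n \<Longrightarrow> K x \<le> D0 x - p x"
    and DK: "\<And>x. x < n \<Longrightarrow> D x \<le> K x + p x"
    and DD: "\<And>x. x < n \<Longrightarrow> D x \<le> D0 x"
    and K: "\<And>x y. x < n \<Longrightarrow> y < n \<Longrightarrow> x \<noteq> y \<Longrightarrow> K y \<le> K x + (w (x, y) + p x - p y) + \<epsilon>"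
    and D: "\<And>x y. x < n \<Longrightarrow> y < n \<Longrightarrow> x \<noteq> y \<Longrightarrow> D y \<le> D0 x + w (x, y)"
    and h: "h = 1 \<or> real h * \<epsilon> < 1"
  shows "covers n w s (k + h) D"
proof -
  \<comment> \<open>Induction on the number \<open>j\<close> of hops beyond \<open>k\<close>: each
    last arc that is stripped off costs one \<open>\<epsilon>\<close>, and walks already within the
    shorter bound lose nothing.\<close>
  have approx: "K v \<le> cost w q - p v + real j * \<epsilon>" if "walk n s q v" "length q \<le> k + j" for q v j
    using that
  proof (induction j arbitrary: q v)
    case 0
    then have "D0 v \<le> cost w q" using cov by (auto simp: covers_def)
    with K0[of v] walk_bound[OF 0(1)] show ?case by simp
  next
    case (Suc j)
    show ?case
    proof (cases "length q \<le> k + j")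
      case True
      from Suc.IH[OF Suc.prems(1) this] \<open>0 < \<epsilon>\<close> show ?thesis by (simp add: algebra_simps)
    next
      case False
      then obtain r e where q: "q = r @ [e]" by (cases q rule: rev_cases) auto
      have e: "walk n s r (fst e)" "snd e = v" "fst e < n" "v < n" "fst e \<noteq> v"
        using Suc.prems(1) unfolding q walk_snoc_iff by auto
      have "K (fst e) \<le> cost w r - p (fst e) + real j * \<epsilon>"
        using Suc.IH[OF e(1)] Suc.prems(2) q by simp
      moreover have "w e = w (fst e, v)" using e(2) by (cases e) auto
      ultimately show ?thesis
        using K[OF e(3-5)] q by (simp add: algebra_simps)
    qed
  qed
  \<comment> \<open>One exact relaxation of the old labels gains one hop whatever the size of
    \<open>\<epsilon>\<close>; this settles \<open>h = 1\<close>.\<close>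
  have one: "D v \<le> cost w q" if "walk n s q v" "length q \<le> Suc k" for q v
  proof (cases "length q \<le> k")
    case True
    then have "D0 v \<le> cost w q" using that cov by (auto simp: covers_def)
    then show ?thesis using DD[OF walk_bound[OF that(1)]] by simp
  next
    case False
    then obtain r e where q: "q = r @ [e]" by (cases q rule: rev_cases) auto
    have e: "walk n s r (fst e)" "snd e = v" "fst e < n" "v < n" "fst e \<noteq> v"
      using that(1) unfolding q walk_snoc_iff by auto
    have "D0 (fst e) \<le> cost w r" using cov e(1) that(2) q by (auto simp: covers_def)
    moreover have "w e = w (fst e, v)" using e(2) by (cases e) auto
    ultimately show ?thesis using D[OF e(3-5)] q by simp
  qed
  have "D v \<le> cost w q" if q: "walk n s q v" and "length q \<le> k + h" and h1: "real h * \<epsilon> < 1" for q v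
  proof -
    have v: "v < n" using walk_bound[OF q] .
    have "D v < cost w q + 1"
      using approx[OF that(1,2)] DK[OF v] h1 by simp
    moreover have "D v \<in> \<int>"
      using att v cost_Ints[OF adm] by (auto simp: attained_def)
    moreover have "cost w q \<in> \<int>" using cost_Ints[OF adm q] .
    ultimately show ?thesis by (auto elim!: Ints_cases)
  qed
  with one h show ?thesis by (auto simp: covers_def)
qed

text \<open>
  \<open>V x \<noteq> 0\<close> marks the settled vertices and \<open>D0\<close> holds the labels at the start of the round. The matrix
  \<open>a\<close> has a zero diagonal, so relaxing a loop changes nothing.
\<close>

definition dijkstra_inv ::
  "nat \<Rightarrow> (nat \<Rightarrow> nat \<Rightarrow> real) \<Rightarrow> (nat \<Rightarrow> real) \<Rightarrow> real \<Rightarrow> (nat \<Rightarrow> real) \<Rightarrow>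
    nat \<Rightarrow> (nat \<Rightarrow> nat) \<Rightarrow> (nat \<Rightarrow> real) \<Rightarrow> (nat \<Rightarrow> real) \<Rightarrow> bool" where
  "dijkstra_inv n a p \<epsilon> D0 k V K D \<longleftrightarrow>
     card {x. x < n \<and> V x \<noteq> 0} = k \<and>
     (\<forall>x<n. D x \<le> K x + p x \<and> K x \<le> D0 x - p x \<and> D x \<le> D0 x) \<and>
     (\<forall>x<n. \<forall>y<n. V x \<noteq> 0 \<longrightarrow>
        K y \<le> K x + (a x y + p x - p y) + \<epsilon> \<and> D y \<le> D0 x + a x y \<and> (V y = 0 \<longrightarrow> K x \<le> K y))"

lemma dijkstra_inv_init:
  "(\<And>x. x < n \<Longrightarrow> V x = 0 \<and> K x = D x - p x) \<Longrightarrow> dijkstra_inv n a p \<epsilon> D 0 V K D"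
  by (auto simp: dijkstra_inv_def)

lemma dijkstra_inv_unsettled:
  assumes "dijkstra_inv n a p \<epsilon> D0 k V K D" "k < n"
  obtains x where "x < n" "V x = 0"
proof (rule ccontr)
  assume "\<not> thesis"
  then have "{x. x < n \<and> V x \<noteq> 0} = {..<n}" using that by auto
  then show False using assms by (auto simp: dijkstra_inv_def)
qed

lemma dijkstra_inv_settled:
  assumes "dijkstra_inv n a p \<epsilon> D0 n V K D" "x < n"
  shows "V x \<noteq> 0"
proof -
  have "card {x. x < n \<and> V x \<noteq> 0} = card {..<n}"
    using assms by (auto simp: dijkstra_inv_def)
  then have "{x. x < n \<and> V x \<noteq> 0} = {..<n}"
    by (intro card_subset_eq) auto
  then show ?thesis using assms(2) by auto
qed

text \<open>The usual argument for nonnegative lengths: settled keys are at most the key of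
  \<open>u\<close>, so a relaxation from \<open>u\<close> cannot lower them, while the unsettled
  keys stay at least as large as that of \<open>u\<close>. Hence the inequalities of settled
  vertices survive and \<open>u\<close> acquires them.\<close>

lemma dijkstra_inv_step:
  assumes inv: "dijkstra_inv n a p \<epsilon> D0 k V K D"
    and u: "u < n" "V u = 0" "\<And>x. x < n \<Longrightarrow> V x = 0 \<Longrightarrow> K u \<le> K x"
    and slack: "\<And>x y. x < n \<Longrightarrow> y < n \<Longrightarrow> - \<epsilon> \<le> a x y + p x - p y"
    and K': "\<And>x. x < n \<Longrightarrow> K' x = min (K x) (K u + (a u x + p u - p x) + \<epsilon>)"
    and D': "\<And>x. x < n \<Longrightarrow> D' x = min (D x) (D u + a u x)"
    and V': "\<And>x. x < n \<Longrightarrow> V' x = (if x = u then 1 else V x)"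
    and "0 < \<epsilon>"
  shows "dijkstra_inv n a p \<epsilon> D0 (Suc k) V' K' D'"
proof -
  have I: "D x \<le> K x + p x" "K x \<le> D0 x - p x" "D x \<le> D0 x" if "x < n" for x
    using inv that by (auto simp: dijkstra_inv_def)
  have J: "K y \<le> K x + (a x y + p x - p y) + \<epsilon>" "D y \<le> D0 x + a x y" "V y = 0 \<Longrightarrow> K x \<le> K y"
    if "x < n" "y < n" "V x \<noteq> 0" for x y
    using inv that by (auto simp: dijkstra_inv_def)
  have same: "K' x = K x" if "x < n" "x = u \<or> V x \<noteq> 0" for x
    using K'[OF that(1)] J(3)[OF that(1) u(1)] u(2) slack[OF u(1) that(1)] that(2) by auto
  have below: "K u \<le> K' y" if "y < n" "V y = 0" for y
    using K'[OF that(1)] u(3)[OF that] slack[OF u(1) that(1)] by auto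
  have "{x. x < n \<and> V' x \<noteq> 0} = insert u {x. x < n \<and> V x \<noteq> 0}"
    using V' u(1) by auto
  then have card: "card {x. x < n \<and> V' x \<noteq> 0} = Suc k"
    using inv u(2) by (simp add: dijkstra_inv_def)
  \<comment> \<open>A key lowered via \<open>u\<close> includes the surcharge
    \<open>\<epsilon>\<close>, whereas the label lowered via \<open>u\<close> does not; this
    preserves the bound of \<open>D'\<close> by \<open>K' + p\<close>.\<close>
  have "D' x \<le> K' x + p x \<and> K' x \<le> D0 x - p x \<and> D' x \<le> D0 x" if "x < n" for x
    using I[OF that] I(1)[OF u(1)] K'[OF that] D'[OF that] \<open>0 < \<epsilon>\<close> by (auto simp: min_def)
  moreover have "K' y \<le> K' x + (a x y + p x - p y) + \<epsilon> \<and> D' y \<le> D0 x + a x y \<and> (V' y = 0 \<longrightarrow> K' x \<le> K' y)"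
    if x: "x < n" and y: "y < n" and "V' x \<noteq> 0" for x y
  proof -
    have xu: "x = u \<or> V x \<noteq> 0" using that V' by (metis)
    have Vy: "V' y = 0 \<Longrightarrow> V y = 0" using V'[OF y] by (auto split: if_splits)
    show ?thesis
    proof (cases "x = u")
      case True
      then show ?thesis
        using same[OF u(1)] below[OF y] Vy K'[OF y] D'[OF y] I(3)[OF u(1)] by auto
    next
      case False
      then have Vx: "V x \<noteq> 0" using xu by simp
      have "K x \<le> K' y" if "V y = 0"
        using J(3)[OF x u(1) Vx u(2)] below[OF y that] by simp
      then show ?thesis
        using J[OF x y Vx] same[OF x xu] Vy K'[OF y] D'[OF y] by auto
    qed
  qed
  ultimately show ?thesis using card by (auto simp: dijkstra_inv_def)
qed

section \<open>Running time bounds for programs\<close>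

primrec nwrites :: "com \<Rightarrow> vname set" where
  "nwrites Skip = {}"
| "nwrites (NAssign x a b) = {x}"
| "nwrites (RAssign x a r) = {}"
| "nwrites (Seq c d) = nwrites c \<union> nwrites d"
| "nwrites (If b c d) = nwrites c \<union> nwrites d"
| "nwrites (While b c) = nwrites c"
| "nwrites (CallOracle x a y r) = {}"

primrec rwrites :: "com \<Rightarrow> vname set" where
  "rwrites Skip = {}"
| "rwrites (NAssign x a b) = {}"
| "rwrites (RAssign x a r) = {x}"
| "rwrites (Seq c d) = rwrites c \<union> rwrites d"
| "rwrites (If b c d) = rwrites c \<union> rwrites d"
| "rwrites (While b c) = rwrites c"
| "rwrites (CallOracle x a y r) = {x}"

primrec straight :: "com \<Rightarrow> bool" where
  "straight Skip = True"
| "straight (NAssign x a b) = True"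
| "straight (RAssign x a r) = True"
| "straight (Seq c d) = (straight c \<and> straight d)"
| "straight (If b c d) = (straight c \<and> straight d)"
| "straight (While b c) = False"
| "straight (CallOracle x a y r) = False"

text \<open>The store transformer of loop-free programs; the values for \<open>While\<close> and
  \<open>CallOracle\<close> are defaults, excluded by \<open>straight\<close>.\<close>

primrec effect :: "com \<Rightarrow> store \<Rightarrow> store" where
  "effect Skip \<sigma> = \<sigma>"
| "effect (NAssign x a b) \<sigma> = set_nat x (nval a \<sigma>) (nval b \<sigma>) \<sigma>"
| "effect (RAssign x a r) \<sigma> = set_real x (nval a \<sigma>) (rval r \<sigma>) \<sigma>"
| "effect (Seq c d) \<sigma> = effect d (effect c \<sigma>)"
| "effect (If b c d) \<sigma> = (if bval b \<sigma> then effect c \<sigma> else effect d \<sigma>)"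
| "effect (While b c) \<sigma> = \<sigma>"
| "effect (CallOracle x a y r) \<sigma> = \<sigma>"

text \<open>A conditional is charged for its dearer branch, so that the bound does not depend on the
  store.\<close>

primrec max_cost :: "com \<Rightarrow> nat" where
  "max_cost Skip = 1"
| "max_cost (NAssign x a b) = 1 + ncost a + ncost b"
| "max_cost (RAssign x a r) = 1 + ncost a + rcost r"
| "max_cost (Seq c d) = max_cost c + max_cost d"
| "max_cost (If b c d) = 1 + bcost b + max (max_cost c) (max_cost d)"
| "max_cost (While b c) = 0"
| "max_cost (CallOracle x a y r) = 0"

lemma nats_set [simp]:
  "nats (set_nat x i k \<sigma>) = (nats \<sigma>)(x := (nats \<sigma> x)(i := k))"
  "nats (set_real x i r \<sigma>) = nats \<sigma>"
  "nats (set_vector x m p \<sigma>) = nats \<sigma>"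
  by (simp_all add: set_nat_def set_real_def set_vector_def)

lemma reals_set [simp]:
  "reals (set_nat x i k \<sigma>) = reals \<sigma>"
  "reals (set_real x i r \<sigma>) = (reals \<sigma>)(x := (reals \<sigma> x)(i := r))"
  "reals (set_vector x m p \<sigma>) = (reals \<sigma>)(x := (\<lambda>i. if i < m then p i else reals \<sigma> x i))"
  by (simp_all add: set_nat_def set_real_def set_vector_def)

text \<open>Arrays outside the syntactic footprint keep their contents. With this fact at hand, loop
  invariants need not list the data that a loop leaves alone.\<close>

definition frame :: "com \<Rightarrow> store \<Rightarrow> store \<Rightarrow> bool" where
  "frame c \<sigma> \<tau> \<longleftrightarrow>
     (\<forall>x. x \<notin> nwrites c \<longrightarrow> nats \<tau> x = nats \<sigma> x) \<and> (\<forall>x. x \<notin> rwrites c \<longrightarrow> reals \<tau> x = reals \<sigma> x)"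

lemma frame_nats: "frame c \<sigma> \<tau> \<Longrightarrow> x \<notin> nwrites c \<Longrightarrow> nats \<tau> x = nats \<sigma> x"
  and frame_reals: "frame c \<sigma> \<tau> \<Longrightarrow> x \<notin> rwrites c \<Longrightarrow> reals \<tau> x = reals \<sigma> x"
  by (auto simp: frame_def)

lemma exec_frame: "exec T orc c \<sigma> t \<tau> \<Longrightarrow> frame c \<sigma> \<tau>"
  unfolding frame_def by (induction rule: exec.induct) auto

text \<open>A total-correctness triple with a time budget \<open>b\<close>. The initial store is
  fixed, so the postcondition can refer to it.\<close>

definition runs ::
  "(nat \<Rightarrow> real \<Rightarrow> real) \<Rightarrow> dual_oracle_fun \<Rightarrow> com \<Rightarrow> store \<Rightarrow> real \<Rightarrow> (store \<Rightarrow> bool) \<Rightarrow> bool" where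
  "runs T orc c \<sigma> b Q \<longleftrightarrow> (\<exists>t \<tau>. exec T orc c \<sigma> t \<tau> \<and> t \<le> b \<and> Q \<tau>)"

lemma runs_mono:
  "runs T orc c \<sigma> b Q \<Longrightarrow> (\<And>\<tau>. Q \<tau> \<Longrightarrow> frame c \<sigma> \<tau> \<Longrightarrow> Q' \<tau>) \<Longrightarrow> b \<le> b' \<Longrightarrow> runs T orc c \<sigma> b' Q'"
  unfolding runs_def using exec_frame by (meson order_trans)

lemma runs_Seq:
  assumes "runs T orc c \<sigma> b R" and "\<And>\<tau>. R \<tau> \<Longrightarrow> frame c \<sigma> \<tau> \<Longrightarrow> runs T orc d \<tau> b' Q"
  shows "runs T orc (Seq c d) \<sigma> (b + b') Q"
proof -
  obtain t \<tau> where 1: "exec T orc c \<sigma> t \<tau>" "t \<le> b" "R \<tau>"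
    using assms(1) by (auto simp: runs_def)
  obtain u \<rho> where "exec T orc d \<tau> u \<rho>" "u \<le> b'" "Q \<rho>"
    using assms(2)[OF 1(3) exec_frame[OF 1(1)]] by (auto simp: runs_def)
  then show ?thesis
    using 1 by (auto simp: runs_def intro!: exI[of _ "t + u"] exI[of _ \<rho>] exec.Seq add_mono)
qed

text \<open>Loop-free code needs no program logic: the postcondition is checked on the computed
  store, and the budget against a syntactic number.\<close>

lemma runs_straight:
  assumes "straight c" "real (max_cost c) \<le> b" "Q (effect c \<sigma>)"
  shows "runs T orc c \<sigma> b Q"
proof -
  have "\<exists>t. exec T orc c \<sigma> t (effect c \<sigma>) \<and> t \<le> real (max_cost c)"
    using assms(1)
  proof (induction c arbitrary: \<sigma>)
    case (Seq c d)
    then obtain t u where t: "exec T orc c \<sigma> t (effect c \<sigma>)" "t \<le> real (max_cost c)"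
      and u: "exec T orc d (effect c \<sigma>) u (effect d (effect c \<sigma>))" "u \<le> real (max_cost d)"
      by (meson straight.simps(4))
    from exec.Seq[OF t(1) u(1)] t(2) u(2) show ?case
      by (intro exI[of _ "t + u"]) simp
  next
    case (If b c d)
    show ?case
    proof (cases "bval b \<sigma>")
      case True
      obtain t where t: "exec T orc c \<sigma> t (effect c \<sigma>)" "t \<le> real (max_cost c)"
        using If by auto
      from exec.IfTrue[OF True t(1)] t(2) True show ?thesis
        by (intro exI[of _ "real (1 + bcost b) + t"]) auto
    next
      case False
      obtain t where t: "exec T orc d \<sigma> t (effect d \<sigma>)" "t \<le> real (max_cost d)"
        using If by auto
      from exec.IfFalse[OF False t(1)] t(2) False show ?thesis
        by (intro exI[of _ "real (1 + bcost b) + t"]) auto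
    qed
  next
    case Skip
    show ?case using exec.Skip[of T orc \<sigma>] by force
  next
    case (NAssign x a b)
    show ?case using exec.NAssign[of T orc x a b \<sigma>] by force
  next
    case (RAssign x a r)
    show ?case using exec.RAssign[of T orc x a r \<sigma>] by force
  qed simp_all
  with assms(2,3) show ?thesis by (force simp: runs_def)
qed

text \<open>The index of \<open>Inv\<close> is a budget of remaining iterations. A true guard forces
  it to be a successor, so at most \<open>m\<close> iterations occur; each pays for the body and one
  test, and the failing test is paid once.\<close>

lemma runs_While:
  assumes "Inv m \<sigma>"
    and step: "\<And>k \<tau>. bval b \<tau> \<Longrightarrow> Inv k \<tau> \<Longrightarrow> frame c \<sigma> \<tau> \<Longrightarrow>
      \<exists>k'. k = Suc k' \<and> runs T orc c \<tau> B (Inv k')"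
    and "0 \<le> B"
  shows "runs T orc (While b c) \<sigma> (real m * (B + 1 + bcost b) + (1 + bcost b))
    (\<lambda>\<tau>. (\<exists>k. Inv k \<tau>) \<and> \<not> bval b \<tau>)"
proof -
  have "runs T orc (While b c) \<tau> (real k * (B + 1 + bcost b) + (1 + bcost b))
      (\<lambda>\<tau>. (\<exists>k. Inv k \<tau>) \<and> \<not> bval b \<tau>)" if "Inv k \<tau>" "frame c \<sigma> \<tau>" for k \<tau>
    using that
  proof (induction k arbitrary: \<tau>)
    case 0
    then have "\<not> bval b \<tau>" using step by blast
    then show ?case
      using 0 \<open>0 \<le> B\<close> exec.WhileFalse[of b \<tau> T orc c] by (force simp: runs_def)
  next
    case (Suc k)
    show ?case
    proof (cases "bval b \<tau>")
      \<comment> \<open>The loop may stop before its budget is spent; the nonnegativity of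
        \<open>B\<close> covers the rest.\<close>
      case False
      with Suc.prems exec.WhileFalse[of b \<tau> T orc c] \<open>0 \<le> B\<close> show ?thesis
        unfolding runs_def
        by (intro exI[of _ "real (1 + bcost b)"] exI[of _ \<tau>]) auto
    next
      case True
      then obtain t \<rho> where t: "exec T orc c \<tau> t \<rho>" "t \<le> B" "Inv k \<rho>"
        using step[OF True Suc.prems] by (auto simp: runs_def)
      have "frame c \<sigma> \<rho>"
        using exec_frame[OF t(1)] Suc.prems(2) by (auto simp: frame_def)
      from Suc.IH[OF t(3) this] obtain u \<rho>' where
        u: "exec T orc (While b c) \<rho> u \<rho>'" "u \<le> real k * (B + 1 + bcost b) + (1 + bcost b)"
          "(\<exists>k. Inv k \<rho>') \<and> \<not> bval b \<rho>'"
        by (auto simp: runs_def)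
      show ?thesis
        unfolding runs_def
        using exec.WhileTrue[OF True t(1) u(1)] t(2) u(2,3)
        by (intro exI[of _ "real (1 + bcost b) + t + u"] exI[of _ \<rho>']) (auto simp: algebra_simps)
    qed
  qed
  then show ?thesis using assms(1) by (simp add: frame_def)
qed

section \<open>Counting loops\<close>

abbreviation nvar :: "vname \<Rightarrow> nexp" where
  "nvar x \<equiv> NArr x (NConst 0)"

abbreviation rvar :: "vname \<Rightarrow> rexp" where
  "rvar x \<equiv> RArr x (NConst 0)"

definition for_n :: "vname \<Rightarrow> com \<Rightarrow> com" where
  "for_n i c = Seq (NAssign i (NConst 0) (NConst 0))
     (While (NLess (nvar i) (nvar ''n''))
       (Seq c (NAssign i (NConst 0) (NAdd (nvar i) (NConst 1)))))"

lemma writes_for_n [simp]: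
  "nwrites (for_n i c) = insert i (nwrites c)" "rwrites (for_n i c) = rwrites c"
  by (auto simp: for_n_def)

text \<open>The invariant counts up, the budget of \<open>runs_While\<close> counts down, and they
  add up to \<open>n\<close>. Per iteration, 12 pays 6 for the increment and 6 for the test; the 9
  is 3 for the initial assignment and 6 for the failing test.\<close>

lemma runs_for_n:
  assumes n: "nats \<sigma> ''n'' 0 = n" and i: "i \<noteq> ''n''" "''n'' \<notin> nwrites c" "i \<notin> nwrites c"
    and base: "Inv 0 (set_nat i 0 0 \<sigma>)"
    and step: "\<And>k \<tau>. k < n \<Longrightarrow> nats \<tau> i 0 = k \<Longrightarrow> frame (for_n i c) \<sigma> \<tau> \<Longrightarrow> Inv k \<tau> \<Longrightarrow>
      runs T orc c \<tau> B (\<lambda>\<rho>. Inv (Suc k) (set_nat i 0 (Suc k) \<rho>))"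
    and "0 \<le> B"
  shows "runs T orc (for_n i c) \<sigma> (real n * (B + 12) + 9) (Inv n)"
proof -
  let ?b = "NLess (nvar i) (nvar ''n'')"
  let ?inc = "NAssign i (NConst 0) (NAdd (nvar i) (NConst 1))"
  let ?I = "\<lambda>m \<tau>. \<exists>k. k + m = n \<and> nats \<tau> i 0 = k \<and> Inv k \<tau>"
  have "runs T orc (While ?b (Seq c ?inc)) (set_nat i 0 0 \<sigma>)
      (real n * (B + 6 + 1 + bcost ?b) + (1 + bcost ?b)) (\<lambda>\<tau>. (\<exists>m. ?I m \<tau>) \<and> \<not> bval ?b \<tau>)"
  proof (rule runs_While)
    show "?I n (set_nat i 0 0 \<sigma>)" using base by simp
  next
    fix m \<tau>
    assume b: "bval ?b \<tau>" and I: "?I m \<tau>" and fr: "frame (Seq c ?inc) (set_nat i 0 0 \<sigma>) \<tau>"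
    have fr': "frame (for_n i c) \<sigma> \<tau>"
      using fr by (auto simp: frame_def)
    have n': "nats \<tau> ''n'' 0 = n"
      using frame_nats[OF fr', of "''n''"] n i by simp
    obtain k where k: "k + m = n" "nats \<tau> i 0 = k" "Inv k \<tau>" using I by blast
    then have "k < n" using b n' by simp
    then obtain m' where m: "m = Suc m'" using k(1) by (cases m) auto
    have "runs T orc (Seq c ?inc) \<tau> (B + 6) (?I m')"
    proof (rule runs_Seq)
      show "runs T orc c \<tau> B (\<lambda>\<rho>. Inv (Suc k) (set_nat i 0 (Suc k) \<rho>))"
        using step[OF \<open>k < n\<close> k(2) fr' k(3)] .
      fix \<rho> assume inv: "Inv (Suc k) (set_nat i 0 (Suc k) \<rho>)" and "frame c \<tau> \<rho>"
      then have "nats \<rho> i 0 = k" using frame_nats i k(2) by metis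
      then show "runs T orc ?inc \<rho> 6 (?I m')"
        using inv k(1) m by (intro runs_straight) auto
    qed
    with m show "\<exists>m'. m = Suc m' \<and> runs T orc (Seq c ?inc) \<tau> (B + 6) (?I m')" by blast
  qed (use \<open>0 \<le> B\<close> in simp)
  moreover have "Inv n \<tau>" if I: "(\<exists>m. ?I m \<tau>) \<and> \<not> bval ?b \<tau>"
      and fr: "frame (While ?b (Seq c ?inc)) (set_nat i 0 0 \<sigma>) \<tau>" for \<tau>
  proof -
    have "nats \<tau> ''n'' 0 = n"
      using frame_nats[OF fr, of "''n''"] n i by simp
    moreover obtain m k where "k + m = n" "nats \<tau> i 0 = k" "Inv k \<tau>" using I by blast
    ultimately have "k = n" using I by simp
    with \<open>Inv k \<tau>\<close> show ?thesis by simp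
  qed
  ultimately have body: "runs T orc (While ?b (Seq c ?inc)) (set_nat i 0 0 \<sigma>) (real n * (B + 12) + 6) (Inv n)"
    by (rule runs_mono) (auto simp: algebra_simps)
  have "runs T orc (for_n i c) \<sigma> (3 + (real n * (B + 12) + 6)) (Inv n)"
    unfolding for_n_def
  proof (rule runs_Seq)
    show "runs T orc (NAssign i (NConst 0) (NConst 0)) \<sigma> 3 (\<lambda>\<tau>. \<tau> = set_nat i 0 0 \<sigma>)"
      by (rule runs_straight) auto
  qed (use body in simp)
  then show ?thesis by (simp add: algebra_simps)
qed


section \<open>The program\<close>

text \<open>\<open>R\<close> tabulates the multiples of \<open>n\<close>, because programs cannot multiply to index the matrix.\<close>

definition row_offsets :: com where
  "row_offsets = for_n ''i''
     (NAssign ''R'' (NAdd (nvar ''i'') (NConst 1)) (NAdd (NArr ''R'' (nvar ''i'')) (nvar ''n'')))"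

text \<open>
  Computes the largest \<open>H \<le> n + 1\<close> with \<open>H * \<epsilon> < 1\<close>, or 1 if there is none, with \<open>e = (H + 1) * \<epsilon>\<close>.
\<close>

definition hop_count :: com where
  "hop_count =
     Seq (NAssign ''H'' (NConst 0) (NConst 1))
     (Seq (RAssign ''e'' (NConst 0) (RAdd (rvar ''eps'') (rvar ''eps'')))
     (for_n ''i''
       (If (RLess (rvar ''e'') (RConst 1))
         (Seq (NAssign ''H'' (NConst 0) (NAdd (nvar ''H'') (NConst 1)))
              (RAssign ''e'' (NConst 0) (RAdd (rvar ''e'') (rvar ''eps''))))
         Skip)))"

text \<open>Row \<open>s\<close> of the matrix holds the costs of the one-arc walks, and its zero
  diagonal entry is the cost of the empty walk at \<open>s\<close>.\<close>

definition init_labels :: com where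
  "init_labels = for_n ''v''
     (RAssign ''D'' (nvar ''v'') (RArr ''W'' (NAdd (NArr ''R'' (nvar ''s'')) (nvar ''v''))))"

definition init_keys :: com where
  "init_keys = for_n ''v''
     (Seq (RAssign ''K'' (nvar ''v'') (RSub (RArr ''D'' (nvar ''v'')) (RArr ''p'' (nvar ''v''))))
          (NAssign ''V'' (nvar ''v'') (NConst 0)))"

text \<open>The candidate \<open>u\<close> starts at 0, which may be settled. The negated
  conjunction says that \<open>u\<close> is settled or has a larger key than
  \<open>v\<close>.\<close>

definition select_min :: com where
  "select_min =
     Seq (NAssign ''u'' (NConst 0) (NConst 0))
     (for_n ''v''
       (If (BAnd (NLess (NArr ''V'' (nvar ''v'')) (NConst 1))
              (BNot (BAnd (NLess (NArr ''V'' (nvar ''u'')) (NConst 1))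
                (BNot (RLess (RArr ''K'' (nvar ''v'')) (RArr ''K'' (nvar ''u'')))))))
         (NAssign ''u'' (NConst 0) (nvar ''v''))
         Skip))"

definition arc_weight :: rexp where
  "arc_weight = RArr ''W'' (NAdd (NArr ''R'' (nvar ''u'')) (nvar ''v''))"

definition new_key :: rexp where
  "new_key = RAdd (RAdd (RArr ''K'' (nvar ''u''))
     (RAdd arc_weight (RSub (RArr ''p'' (nvar ''u'')) (RArr ''p'' (nvar ''v''))))) (rvar ''eps'')"

definition new_label :: rexp where
  "new_label = RAdd (RArr ''D'' (nvar ''u'')) arc_weight"

definition relax_arcs :: com where
  "relax_arcs = for_n ''v''
     (Seq (If (RLess new_key (RArr ''K'' (nvar ''v''))) (RAssign ''K'' (nvar ''v'') new_key) Skip)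
          (If (RLess new_label (RArr ''D'' (nvar ''v''))) (RAssign ''D'' (nvar ''v'') new_label) Skip))"

definition improve_round :: com where
  "improve_round =
     Seq init_keys
     (for_n ''k''
       (Seq select_min
       (Seq (NAssign ''V'' (nvar ''u'') (NConst 1)) relax_arcs)))"

text \<open>\<open>rem\<close> counts the hops still to be covered. Truncated subtraction ends it at
  0 even if the last round covers more than is needed.\<close>

definition sssp :: com where
  "sssp =
     Seq row_offsets
     (Seq hop_count
     (Seq (CallOracle ''p'' (nvar ''n'') ''W'' (rvar ''eps''))
     (Seq init_labels
     (Seq (NAssign ''rem'' (NConst 0) (nvar ''n''))
     (While (NLess (NConst 0) (nvar ''rem''))
       (Seq improve_round (NAssign ''rem'' (NConst 0) (NSub (nvar ''rem'') (nvar ''H'')))))))))"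

lemmas program_defs = row_offsets_def hop_count_def init_labels_def init_keys_def select_min_def
  arc_weight_def new_key_def new_label_def relax_arcs_def improve_round_def

section \<open>Correctness and running time of the subroutines\<close>

lemma runs_row_offsets:
  assumes "nats \<sigma> ''n'' 0 = n" "nats \<sigma> ''R'' 0 = 0"
  shows "runs T orc row_offsets \<sigma> (40 * real n + 9) (\<lambda>\<tau>. \<forall>j\<le>n. nats \<tau> ''R'' j = j * n)"
proof -
  let ?body = "NAssign ''R'' (NAdd (nvar ''i'') (NConst 1)) (NAdd (NArr ''R'' (nvar ''i'')) (nvar ''n''))"
  let ?I = "\<lambda>k \<tau>. \<forall>j\<le>k. nats \<tau> ''R'' j = j * n"
  have "runs T orc row_offsets \<sigma> (real n * (28 + 12) + 9) (?I n)"
    unfolding row_offsets_def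
  proof (rule runs_for_n[where Inv = ?I])
    fix k \<tau>
    assume k: "k < n" "nats \<tau> ''i'' 0 = k" "?I k \<tau>" and fr: "frame (for_n ''i'' ?body) \<sigma> \<tau>"
    have "nats \<tau> ''n'' = nats \<sigma> ''n''"
      using frame_nats[OF fr] by simp
    then show "runs T orc ?body \<tau> 28 (\<lambda>\<rho>. ?I (Suc k) (set_nat ''i'' 0 (Suc k) \<rho>))"
      using k assms by (intro runs_straight) (auto simp: le_Suc_eq)
  qed (use assms in auto)
  then show ?thesis by (simp add: algebra_simps)
qed

text \<open>The bound \<open>real h * \<epsilon> < 1\<close> makes a round of \<open>h\<close> hops
  exact. The last disjunction says that \<open>h\<close> is large enough: either a single round
  covers everything, or \<open>h\<close> is of order \<open>1 / \<epsilon>\<close>.\<close>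

lemma runs_hop_count:
  assumes n: "nats \<sigma> ''n'' 0 = n" and eps: "reals \<sigma> ''eps'' 0 = \<epsilon>"
  shows "runs T orc hop_count \<sigma> (60 * real n + 30)
    (\<lambda>\<tau>. \<exists>h. nats \<tau> ''H'' 0 = h \<and> 1 \<le> h \<and> (h = 1 \<or> real h * \<epsilon> < 1) \<and> (n < h \<or> 1 \<le> real (Suc h) * \<epsilon>))"
proof -
  let ?body = "If (RLess (rvar ''e'') (RConst 1))
         (Seq (NAssign ''H'' (NConst 0) (NAdd (nvar ''H'') (NConst 1)))
              (RAssign ''e'' (NConst 0) (RAdd (rvar ''e'') (rvar ''eps''))))
         Skip"
  let ?I = "\<lambda>k \<tau>. \<exists>h. nats \<tau> ''H'' 0 = h \<and> reals \<tau> ''e'' 0 = real (Suc h) * \<epsilon> \<and> 1 \<le> h \<and>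
      (h = 1 \<or> real h * \<epsilon> < 1) \<and> (k < h \<or> 1 \<le> real (Suc h) * \<epsilon>)"
  have loop: "runs T orc (for_n ''i'' ?body) \<tau> (real n * (48 + 12) + 9) (?I n)"
    if \<tau>: "nats \<tau> ''n'' 0 = n" "reals \<tau> ''eps'' 0 = \<epsilon>" "nats \<tau> ''H'' 0 = 1" "reals \<tau> ''e'' 0 = 2 * \<epsilon>" for \<tau>
  proof (rule runs_for_n[where Inv = ?I])
    fix k \<rho>
    assume I: "?I k \<rho>" and fr: "frame (for_n ''i'' ?body) \<tau> \<rho>"
    have "reals \<rho> ''eps'' = reals \<tau> ''eps''"
      using frame_reals[OF fr] by simp
    then have e: "reals \<rho> ''eps'' 0 = \<epsilon>" using \<tau> by simp
    show "runs T orc ?body \<rho> 48 (\<lambda>\<rho>. ?I (Suc k) (set_nat ''i'' 0 (Suc k) \<rho>))"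
      using I e by (intro runs_straight) (auto simp: algebra_simps)
  qed (use \<tau> in auto)
  have "runs T orc hop_count \<sigma> (5 + (10 + (real n * (48 + 12) + 9))) (?I n)"
    unfolding hop_count_def
  proof (rule runs_Seq)
    let ?c = "NAssign ''H'' (NConst 0) (NConst 1)"
    show "runs T orc ?c \<sigma> 5 (\<lambda>\<tau>. \<tau> = effect ?c \<sigma>)" by (rule runs_straight) auto
    fix \<tau> assume \<tau>: "\<tau> = effect ?c \<sigma>"
    let ?d = "RAssign ''e'' (NConst 0) (RAdd (rvar ''eps'') (rvar ''eps''))"
    show "runs T orc (Seq ?d (for_n ''i'' ?body)) \<tau> (10 + (real n * (48 + 12) + 9)) (?I n)"
    proof (rule runs_Seq)
      show "runs T orc ?d \<tau> 10 (\<lambda>\<rho>. \<rho> = effect ?d \<tau>)" by (rule runs_straight) auto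
      fix \<rho> assume "\<rho> = effect ?d \<tau>"
      with \<tau> n eps show "runs T orc (for_n ''i'' ?body) \<rho> (real n * (48 + 12) + 9) (?I n)"
        by (intro loop) auto
    qed
  qed
  then show ?thesis by (rule runs_mono) auto
qed

lemma runs_init_labels:
  assumes "nats \<sigma> ''n'' 0 = n" "nats \<sigma> ''s'' 0 = s" "s < n" "\<And>j. j \<le> n \<Longrightarrow> nats \<sigma> ''R'' j = j * n"
  shows "runs T orc init_labels \<sigma> (40 * real n + 9) (\<lambda>\<tau>. \<forall>v<n. reals \<tau> ''D'' v = reals \<sigma> ''W'' (s * n + v))"
proof -
  let ?body = "RAssign ''D'' (nvar ''v'') (RArr ''W'' (NAdd (NArr ''R'' (nvar ''s'')) (nvar ''v'')))"
  let ?I = "\<lambda>k \<tau>. \<forall>v<k. reals \<tau> ''D'' v = reals \<sigma> ''W'' (s * n + v)"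
  have "runs T orc init_labels \<sigma> (real n * (28 + 12) + 9) (?I n)"
    unfolding init_labels_def
  proof (rule runs_for_n[where Inv = ?I])
    fix k \<tau>
    assume k: "k < n" "nats \<tau> ''v'' 0 = k" "?I k \<tau>" and fr: "frame (for_n ''v'' ?body) \<sigma> \<tau>"
    have "nats \<tau> ''R'' = nats \<sigma> ''R''" "nats \<tau> ''s'' = nats \<sigma> ''s''" "reals \<tau> ''W'' = reals \<sigma> ''W''"
      using frame_nats[OF fr] frame_reals[OF fr] by simp_all
    then show "runs T orc ?body \<tau> 28 (\<lambda>\<rho>. ?I (Suc k) (set_nat ''v'' 0 (Suc k) \<rho>))"
      using k assms by (intro runs_straight) (auto simp: less_Suc_eq)
  qed (use assms in auto)
  then show ?thesis by (simp add: algebra_simps)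
qed

lemma runs_init_keys:
  assumes "nats \<sigma> ''n'' 0 = n"
  shows "runs T orc init_keys \<sigma> (40 * real n + 9)
    (\<lambda>\<tau>. \<forall>v<n. nats \<tau> ''V'' v = 0 \<and> reals \<tau> ''K'' v = reals \<sigma> ''D'' v - reals \<sigma> ''p'' v)"
proof -
  let ?body = "Seq (RAssign ''K'' (nvar ''v'') (RSub (RArr ''D'' (nvar ''v'')) (RArr ''p'' (nvar ''v''))))
          (NAssign ''V'' (nvar ''v'') (NConst 0))"
  let ?I = "\<lambda>k \<tau>. \<forall>v<k. nats \<tau> ''V'' v = 0 \<and> reals \<tau> ''K'' v = reals \<sigma> ''D'' v - reals \<sigma> ''p'' v"
  have "runs T orc init_keys \<sigma> (real n * (28 + 12) + 9) (?I n)"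
    unfolding init_keys_def
  proof (rule runs_for_n[where Inv = ?I])
    fix k \<tau>
    assume k: "k < n" "nats \<tau> ''v'' 0 = k" "?I k \<tau>"
      and fr: "frame (for_n ''v'' ?body) \<sigma> \<tau>"
    have "reals \<tau> ''D'' = reals \<sigma> ''D''" "reals \<tau> ''p'' = reals \<sigma> ''p''"
      using frame_reals[OF fr] by simp_all
    then show "runs T orc ?body \<tau> 28 (\<lambda>\<rho>. ?I (Suc k) (set_nat ''v'' 0 (Suc k) \<rho>))"
      using k assms by (intro runs_straight) (auto simp: less_Suc_eq)
  qed (use assms in auto)
  then show ?thesis by (simp add: algebra_simps)
qed

text \<open>The minimality claim is conditional on an unsettled vertex, because the scanned prefix
  may not contain one yet.\<close>

lemma runs_select_min:
  assumes "nats \<sigma> ''n'' 0 = n" "0 < n"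
  shows "runs T orc select_min \<sigma> (60 * real n + 12)
    (\<lambda>\<tau>. \<exists>u<n. nats \<tau> ''u'' 0 = u \<and>
      (\<forall>x<n. nats \<sigma> ''V'' x = 0 \<longrightarrow> nats \<sigma> ''V'' u = 0 \<and> reals \<sigma> ''K'' u \<le> reals \<sigma> ''K'' x))"
proof -
  let ?b = "BAnd (NLess (NArr ''V'' (nvar ''v'')) (NConst 1))
              (BNot (BAnd (NLess (NArr ''V'' (nvar ''u'')) (NConst 1))
                (BNot (RLess (RArr ''K'' (nvar ''v'')) (RArr ''K'' (nvar ''u''))))))"
  let ?body = "If ?b (NAssign ''u'' (NConst 0) (nvar ''v'')) Skip"
  let ?I = "\<lambda>k \<tau>. \<exists>u<n. nats \<tau> ''u'' 0 = u \<and>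
      (\<forall>x<k. nats \<sigma> ''V'' x = 0 \<longrightarrow> nats \<sigma> ''V'' u = 0 \<and> reals \<sigma> ''K'' u \<le> reals \<sigma> ''K'' x)"
  have "runs T orc select_min \<sigma> (3 + (real n * (48 + 12) + 9)) (?I n)"
    unfolding select_min_def
  proof (rule runs_Seq)
    let ?c = "NAssign ''u'' (NConst 0) (NConst 0)"
    show "runs T orc ?c \<sigma> 3 (\<lambda>\<tau>. nats \<tau> ''u'' 0 = 0)" by (rule runs_straight) auto
    fix \<rho> assume 2: "nats \<rho> ''u'' 0 = 0" "frame ?c \<sigma> \<rho>"
    show "runs T orc (for_n ''v'' ?body) \<rho> (real n * (48 + 12) + 9) (?I n)"
    proof (rule runs_for_n[where Inv = ?I])
      fix k \<tau>
      assume k: "k < n" "nats \<tau> ''v'' 0 = k" and I: "?I k \<tau>"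
        and fr: "frame (for_n ''v'' ?body) \<rho> \<tau>"
      have V: "nats \<tau> ''V'' = nats \<sigma> ''V''" "reals \<tau> ''K'' = reals \<sigma> ''K''"
        using frame_nats[OF fr] frame_reals[OF fr] frame_nats[OF 2(2)] frame_reals[OF 2(2)] by simp_all
      obtain u where u: "u < n" "nats \<tau> ''u'' 0 = u"
        "\<And>x. x < k \<Longrightarrow> nats \<sigma> ''V'' x = 0 \<Longrightarrow> nats \<sigma> ''V'' u = 0 \<and> reals \<sigma> ''K'' u \<le> reals \<sigma> ''K'' x"
        using I by auto
      show "runs T orc ?body \<tau> 48 (\<lambda>\<rho>. ?I (Suc k) (set_nat ''v'' 0 (Suc k) \<rho>))"
      proof (rule runs_straight)
        show "?I (Suc k) (set_nat ''v'' 0 (Suc k) (effect ?body \<tau>))"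
        proof (cases "bval ?b \<tau>")
          case True
          then show ?thesis
            using k V u by (fastforce simp: less_Suc_eq)
        next
          case False
          then show ?thesis
            using k V u by (auto simp: less_Suc_eq)
        qed
      qed auto
    qed (use assms 2 frame_nats[OF 2(2), of "''n''"] in auto)
  qed
  then show ?thesis by (simp add: algebra_simps)
qed

lemma runs_relax_arcs:
  fixes a :: "nat \<Rightarrow> nat \<Rightarrow> real"
  assumes n: "nats \<sigma> ''n'' 0 = n" and u: "nats \<sigma> ''u'' 0 = u" "u < n"
    and R: "\<And>j. j \<le> n \<Longrightarrow> nats \<sigma> ''R'' j = j * n"
    and a: "\<And>v. v < n \<Longrightarrow> reals \<sigma> ''W'' (u * n + v) = a u v"
    and auu: "a u u = 0" and eps: "reals \<sigma> ''eps'' 0 = \<epsilon>" "0 < \<epsilon>"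
  shows "runs T orc relax_arcs \<sigma> (120 * real n + 9)
    (\<lambda>\<tau>. (\<forall>v<n. reals \<tau> ''K'' v =
              min (reals \<sigma> ''K'' v) (reals \<sigma> ''K'' u + (a u v + reals \<sigma> ''p'' u - reals \<sigma> ''p'' v) + \<epsilon>)) \<and>
         (\<forall>v<n. reals \<tau> ''D'' v = min (reals \<sigma> ''D'' v) (reals \<sigma> ''D'' u + a u v)))"
proof -
  let ?K = "\<lambda>v. min (reals \<sigma> ''K'' v) (reals \<sigma> ''K'' u + (a u v + reals \<sigma> ''p'' u - reals \<sigma> ''p'' v) + \<epsilon>)"
  let ?D = "\<lambda>v. min (reals \<sigma> ''D'' v) (reals \<sigma> ''D'' u + a u v)"
  let ?body = "Seq (If (RLess new_key (RArr ''K'' (nvar ''v''))) (RAssign ''K'' (nvar ''v'') new_key) Skip)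
          (If (RLess new_label (RArr ''D'' (nvar ''v''))) (RAssign ''D'' (nvar ''v'') new_label) Skip)"
  let ?I = "\<lambda>k \<tau>. \<forall>v<n. reals \<tau> ''K'' v = (if v < k then ?K v else reals \<sigma> ''K'' v) \<and>
       reals \<tau> ''D'' v = (if v < k then ?D v else reals \<sigma> ''D'' v)"
  have "runs T orc relax_arcs \<sigma> (real n * (108 + 12) + 9) (?I n)"
    unfolding relax_arcs_def
  proof (rule runs_for_n[where Inv = ?I])
    fix k \<tau>
    assume k: "k < n" "nats \<tau> ''v'' 0 = k" and I: "?I k \<tau>"
      and fr: "frame (for_n ''v'' ?body) \<sigma> \<tau>"
    have eq: "nats \<tau> ''R'' = nats \<sigma> ''R''" "nats \<tau> ''u'' = nats \<sigma> ''u''" "reals \<tau> ''W'' = reals \<sigma> ''W''"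
      "reals \<tau> ''p'' = reals \<sigma> ''p''" "reals \<tau> ''eps'' = reals \<sigma> ''eps''"
      using frame_nats[OF fr] frame_reals[OF fr] by simp_all
    \<comment> \<open>The scan also visits \<open>u\<close> itself. With a zero diagonal and
      \<open>\<epsilon>\<close> positive, that leaves the key and the label of \<open>u\<close>
      unchanged, so all relaxations use the same values.\<close>
    have Ku: "reals \<tau> ''K'' u = reals \<sigma> ''K'' u" "reals \<tau> ''D'' u = reals \<sigma> ''D'' u"
      using I u auu \<open>0 < \<epsilon>\<close> by (auto simp: min_def)
    have Kk: "reals \<tau> ''K'' k = reals \<sigma> ''K'' k" "reals \<tau> ''D'' k = reals \<sigma> ''D'' k"
      using I k by auto
    have w: "rval arc_weight \<tau> = a u k"
      using eq k u R[of u] a[of k] by (simp add: arc_weight_def)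
    have nk: "rval new_key \<tau> = reals \<sigma> ''K'' u + (a u k + reals \<sigma> ''p'' u - reals \<sigma> ''p'' k) + \<epsilon>"
      using eq k u w Ku eps by (simp add: new_key_def)
    \<comment> \<open>The label is tested after a possible write to \<open>K\<close>, which
      \<open>new_label\<close> does not read.\<close>
    have nl: "rval new_label (set_real ''K'' i r \<tau>) = reals \<sigma> ''D'' u + a u k"
      "rval new_label \<tau> = reals \<sigma> ''D'' u + a u k" for i r
      using eq k u w Ku eps by (simp_all add: new_label_def arc_weight_def)
    show "runs T orc ?body \<tau> 108 (\<lambda>\<rho>. ?I (Suc k) (set_nat ''v'' 0 (Suc k) \<rho>))"
    proof (rule runs_straight)
      show "?I (Suc k) (set_nat ''v'' 0 (Suc k) (effect ?body \<tau>))"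
        using I k nk nl Kk by (auto simp: less_Suc_eq)
    qed (auto simp: new_key_def new_label_def arc_weight_def)
  qed (use assms in auto)
  then show ?thesis by (rule runs_mono) (auto simp: algebra_simps)
qed

section \<open>One round of label improvement as a program\<close>

definition loaded :: "nat \<Rightarrow> (nat \<Rightarrow> nat \<Rightarrow> real) \<Rightarrow> (nat \<Rightarrow> real) \<Rightarrow> real \<Rightarrow> store \<Rightarrow> bool" where
  "loaded n a p \<epsilon> \<sigma> \<longleftrightarrow>
     nats \<sigma> ''n'' 0 = n \<and> (\<forall>j\<le>n. nats \<sigma> ''R'' j = j * n) \<and>
     (\<forall>x<n. \<forall>y<n. reals \<sigma> ''W'' (x * n + y) = a x y) \<and>
     reals \<sigma> ''eps'' 0 = \<epsilon> \<and> reals \<sigma> ''p'' = p"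

lemma loaded_frame:
  assumes "frame c \<sigma> \<tau>" "nwrites c \<inter> {''n'', ''R''} = {}" "rwrites c \<inter> {''W'', ''eps'', ''p''} = {}"
    and "loaded n a p \<epsilon> \<sigma>"
  shows "loaded n a p \<epsilon> \<tau>"
  using assms(2-4) frame_nats[OF assms(1)] frame_reals[OF assms(1)]
  by (auto simp: loaded_def)

text \<open>Each of the \<open>n\<close> iterations selects, settles and relaxes in linear time and
  is one application of \<open>dijkstra_inv_step\<close>. Labels change by relaxation only, so they
  stay attained.\<close>

lemma runs_improve_round:
  fixes a :: "nat \<Rightarrow> nat \<Rightarrow> real"
  assumes ld: "loaded n a p \<epsilon> \<sigma>" and n: "0 < n" and \<epsilon>: "0 < \<epsilon>"
    and slack: "\<And>x y. x < n \<Longrightarrow> y < n \<Longrightarrow> - \<epsilon> \<le> a x y + p x - p y"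
    and a: "\<And>x y. x < n \<Longrightarrow> y < n \<Longrightarrow> a x y = (if x = y then 0 else w (x, y))"
    and att: "attained n w s (reals \<sigma> ''D'')"
  shows "runs T orc improve_round \<sigma> (180 * real n ^ 2 + 77 * real n + 18)
    (\<lambda>\<tau>. dijkstra_inv n a p \<epsilon> (reals \<sigma> ''D'') n (nats \<tau> ''V'') (reals \<tau> ''K'') (reals \<tau> ''D'') \<and>
         attained n w s (reals \<tau> ''D''))"
proof -
  let ?old = "reals \<sigma> ''D''"
  let ?I = "\<lambda>k \<tau>. dijkstra_inv n a p \<epsilon> ?old k (nats \<tau> ''V'') (reals \<tau> ''K'') (reals \<tau> ''D'') \<and>
         attained n w s (reals \<tau> ''D'')"
  let ?settle = "NAssign ''V'' (nvar ''u'') (NConst 1)"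
  let ?body = "Seq select_min (Seq ?settle relax_arcs)"
  have body: "runs T orc ?body \<tau> (180 * real n + 25) (?I (Suc k))"
    if k: "k < n" and ld: "loaded n a p \<epsilon> \<tau>" and I: "?I k \<tau>" for k \<tau>
  proof -
    let ?V = "nats \<tau> ''V''" and ?K = "reals \<tau> ''K''" and ?D = "reals \<tau> ''D''"
    have "runs T orc ?body \<tau> ((60 * real n + 12) + (4 + (120 * real n + 9))) (?I (Suc k))"
    proof (rule runs_Seq[OF runs_select_min])
      show "nats \<tau> ''n'' 0 = n" using ld by (simp add: loaded_def)
      show "0 < n" by fact
    next
      fix \<rho>
      assume "\<exists>u<n. nats \<rho> ''u'' 0 = u \<and> (\<forall>x<n. ?V x = 0 \<longrightarrow> ?V u = 0 \<and> ?K u \<le> ?K x)"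
        and fr: "frame select_min \<tau> \<rho>"
      then obtain u where u: "u < n" "nats \<rho> ''u'' 0 = u"
        "\<And>x. x < n \<Longrightarrow> ?V x = 0 \<Longrightarrow> ?V u = 0 \<and> ?K u \<le> ?K x"
        by blast
      have same: "nats \<rho> ''V'' = ?V" "reals \<rho> ''K'' = ?K" "reals \<rho> ''D'' = ?D"
        using frame_nats[OF fr] frame_reals[OF fr] by (simp_all add: select_min_def)
      have ld': "loaded n a p \<epsilon> \<rho>"
        using loaded_frame[OF fr _ _ ld] by (simp add: select_min_def)
      \<comment> \<open>Fewer than \<open>n\<close> vertices are settled, so the conditional
        guarantee of the selection applies.\<close>
      obtain x where "x < n" "?V x = 0"
        using dijkstra_inv_unsettled I k by blast
      with u(3) have Vu: "?V u = 0" by blast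
      show "runs T orc (Seq ?settle relax_arcs) \<rho> (4 + (120 * real n + 9)) (?I (Suc k))"
      proof (rule runs_Seq)
        show "runs T orc ?settle \<rho> 4 (\<lambda>\<rho>'. \<rho>' = effect ?settle \<rho>)"
          by (rule runs_straight) auto
      next
        fix \<rho>'
        assume \<rho>': "\<rho>' = effect ?settle \<rho>" and fr': "frame ?settle \<rho> \<rho>'"
        have ld'': "loaded n a p \<epsilon> \<rho>'"
          using loaded_frame[OF fr' _ _ ld'] by simp
        have "runs T orc relax_arcs \<rho>' (120 * real n + 9)
          (\<lambda>\<tau>. (\<forall>v<n. reals \<tau> ''K'' v =
              min (reals \<rho>' ''K'' v) (reals \<rho>' ''K'' u + (a u v + reals \<rho>' ''p'' u - reals \<rho>' ''p'' v) + \<epsilon>)) \<and>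
            (\<forall>v<n. reals \<tau> ''D'' v = min (reals \<rho>' ''D'' v) (reals \<rho>' ''D'' u + a u v)))"
          using ld'' u \<epsilon> a[of u u] \<rho>' by (intro runs_relax_arcs) (auto simp: loaded_def)
        then show "runs T orc relax_arcs \<rho>' (120 * real n + 9) (?I (Suc k))"
        proof (rule runs_mono)
          fix \<tau>'
          assume post: "(\<forall>v<n. reals \<tau>' ''K'' v =
              min (reals \<rho>' ''K'' v) (reals \<rho>' ''K'' u + (a u v + reals \<rho>' ''p'' u - reals \<rho>' ''p'' v) + \<epsilon>)) \<and>
            (\<forall>v<n. reals \<tau>' ''D'' v = min (reals \<rho>' ''D'' v) (reals \<rho>' ''D'' u + a u v))"
            and fr'': "frame relax_arcs \<rho>' \<tau>'"
          have p: "reals \<rho>' ''p'' = p" using ld'' by (simp add: loaded_def)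
          have K': "reals \<tau>' ''K'' v = min (?K v) (?K u + (a u v + p u - p v) + \<epsilon>)"
            and D': "reals \<tau>' ''D'' v = min (?D v) (?D u + a u v)" if "v < n" for v
            using post that p same \<rho>' by auto
          have "nats \<tau>' ''V'' = nats \<rho>' ''V''"
            using frame_nats[OF fr''] by (simp add: relax_arcs_def)
          then have V': "nats \<tau>' ''V'' v = (if v = u then 1 else ?V v)" for v
            using \<rho>' u same by simp
          have "dijkstra_inv n a p \<epsilon> ?old (Suc k) (nats \<tau>' ''V'') (reals \<tau>' ''K'') (reals \<tau>' ''D'')"
            using dijkstra_inv_step[OF I[THEN conjunct1] u(1) Vu _ slack K' D' V' \<epsilon>] u(3) by blast
          moreover have "attained n w s (reals \<tau>' ''D'')"
          proof (rule attained_relax)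
            show "attained n w s ?D" using I by blast
            show "u < n" by fact
            show "reals \<tau>' ''D'' v = ?D v \<or> reals \<tau>' ''D'' v = ?D u + w (u, v) \<and> u \<noteq> v"
              if "v < n" for v
              using D'[OF that] a[OF u(1) that] by (auto simp: min_def)
          qed
          ultimately show "?I (Suc k) \<tau>'" by blast
        qed simp
      qed
    qed
    then show ?thesis by (simp add: algebra_simps)
  qed
  have "runs T orc improve_round \<sigma> ((40 * real n + 9) + (real n * ((180 * real n + 25) + 12) + 9)) (?I n)"
    unfolding improve_round_def
  proof (rule runs_Seq[OF runs_init_keys])
    show "nats \<sigma> ''n'' 0 = n" using ld by (simp add: loaded_def)
  next
    fix \<tau>
    assume K: "\<forall>v<n. nats \<tau> ''V'' v = 0 \<and> reals \<tau> ''K'' v = ?old v - reals \<sigma> ''p'' v"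
      and fr: "frame init_keys \<sigma> \<tau>"
    have ld': "loaded n a p \<epsilon> \<tau>"
      using loaded_frame[OF fr _ _ ld] by (simp add: init_keys_def)
    have D: "reals \<tau> ''D'' = ?old" using frame_reals[OF fr] by (simp add: init_keys_def)
    have p: "reals \<sigma> ''p'' = p" using ld by (simp add: loaded_def)
    show "runs T orc (for_n ''k'' ?body) \<tau> (real n * ((180 * real n + 25) + 12) + 9) (?I n)"
    proof (rule runs_for_n[where Inv = ?I])
      show "nats \<tau> ''n'' 0 = n" using ld' by (simp add: loaded_def)
      show "?I 0 (set_nat ''k'' 0 0 \<tau>)"
        using K D p att by (auto intro!: dijkstra_inv_init)
    next
      fix k \<rho>
      assume k: "k < n" and fr: "frame (for_n ''k'' ?body) \<tau> \<rho>" and I: "?I k \<rho>"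
      have "loaded n a p \<epsilon> \<rho>"
        using loaded_frame[OF fr _ _ ld'] by (simp add: program_defs)
      from body[OF k this I]
      show "runs T orc ?body \<rho> (180 * real n + 25) (\<lambda>\<rho>. ?I (Suc k) (set_nat ''k'' 0 (Suc k) \<rho>))"
        by simp
    qed (auto simp: program_defs)
  qed
  then show ?thesis by (rule runs_mono) (auto simp: algebra_simps power2_eq_square)
qed

section \<open>The whole algorithm: number of rounds and total time\<close>

lemma runs_sssp:
  assumes orc: "dual_oracle T orc" and adm: "admissible n w" and s: "s < n" and \<epsilon>: "0 < \<epsilon>"
  shows "runs T orc sssp (input_store n w s \<epsilon>) (T n \<epsilon> + 489 * real n ^ 2 + 574 * (real n ^ 3 * \<epsilon>))
    (outputs_distances n w s)"
proof -
  let ?in = "input_store n w s \<epsilon>"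
  let ?W = "matrix_of_weight n w"
  define a where "a x y = ?W (x * n + y)" for x y
  \<comment> \<open>The call overwrites only the first \<open>n\<close> cells of an array that is
    zero initially.\<close>
  define p where "p i = (if i < n then orc n (weight_of_matrix n ?W) \<epsilon> i else 0)" for i
  have a: "a x y = (if x = y then 0 else w (x, y))" if "x < n" "y < n" for x y
    using that matrix_of_weight_entry by (simp add: a_def)
  \<comment> \<open>On the diagonal this is just positivity of \<open>\<epsilon>\<close>; two
    distinct vertices give \<open>2 \<le> n\<close>, where the oracle's guarantee holds.\<close>
  have slack: "- \<epsilon> \<le> a x y + p x - p y" if xy: "x < n" "y < n" for x y
  proof (cases "x = y")
    case True
    then show ?thesis using \<epsilon> a[OF xy] by simp
  next
    case False
    then have "2 \<le> n" using xy by linarith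
    moreover have adm': "admissible n (weight_of_matrix n ?W)"
      using admissible_cong[OF adm] weight_of_matrix_of_weight by blast
    ultimately have "suboptimal n (weight_of_matrix n ?W) \<epsilon> (orc n (weight_of_matrix n ?W) \<epsilon>)"
      using orc \<epsilon> by (simp add: dual_oracle_def)
    from suboptimal_slack[OF adm' this xy False] show ?thesis
      using weight_of_matrix_of_weight[OF xy False] a[OF xy] False xy by (simp add: p_def)
  qed
  let ?loop_body = "Seq improve_round (NAssign ''rem'' (NConst 0) (NSub (nvar ''rem'') (nvar ''H'')))"
  let ?loop = "While (NLess (NConst 0) (nvar ''rem'')) ?loop_body"
  let ?m = "\<lambda>h. n div h + 1"
  let ?B = "180 * real n ^ 2 + 77 * real n + 25"
  let ?J = "\<lambda>k \<tau>. attained n w s (reals \<tau> ''D'') \<and> covers n w s k (reals \<tau> ''D'')"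
  have loop: "runs T orc ?loop \<sigma> (real (?m h) * (?B + 5) + 5) (outputs_distances n w s)"
    if ld: "loaded n a p \<epsilon> \<sigma>" and h: "nats \<sigma> ''H'' 0 = h" "1 \<le> h" "h = 1 \<or> real h * \<epsilon> < 1"
      and rem: "nats \<sigma> ''rem'' 0 = n" and J: "?J 0 \<sigma>" for \<sigma> h
  proof -
    \<comment> \<open>With \<open>r\<close> hops left, the labels cover \<open>n - r\<close> hops
      and \<open>m\<close> rounds of \<open>h\<close> hops suffice for the rest.\<close>
    let ?I = "\<lambda>m \<tau>. \<exists>r. nats \<tau> ''rem'' 0 = r \<and> r \<le> m * h \<and> r \<le> n \<and> ?J (n - r) \<tau>"
    have "runs T orc ?loop \<sigma> (real (?m h) * (?B + 1 + bcost (NLess (NConst 0) (nvar ''rem''))) +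
        (1 + bcost (NLess (NConst 0) (nvar ''rem''))))
      (\<lambda>\<tau>. (\<exists>m. ?I m \<tau>) \<and> \<not> bval (NLess (NConst 0) (nvar ''rem'')) \<tau>)"
    proof (rule runs_While)
      have "n < ?m h * h" using h(2) dividend_less_div_times[of h n] by simp
      then show "?I (?m h) \<sigma>" using rem J by simp
    next
      fix m \<tau>
      assume b: "bval (NLess (NConst 0) (nvar ''rem'')) \<tau>" and "?I m \<tau>"
        and fr: "frame ?loop_body \<sigma> \<tau>"
      then obtain r where r: "nats \<tau> ''rem'' 0 = r" "0 < r" "r \<le> m * h" "r \<le> n" "?J (n - r) \<tau>"
        by auto
      obtain m' where m: "m = Suc m'" using r by (cases m) auto
      have ld': "loaded n a p \<epsilon> \<tau>"
        using loaded_frame[OF fr _ _ ld] by (simp add: program_defs)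
      have h': "nats \<tau> ''H'' 0 = h"
        using frame_nats[OF fr, of "''H''"] h by (simp add: program_defs)
      have "runs T orc ?loop_body \<tau> ((180 * real n ^ 2 + 77 * real n + 18) + 7) (?I m')"
      proof (rule runs_Seq[OF runs_improve_round])
        fix \<rho>
        assume post: "dijkstra_inv n a p \<epsilon> (reals \<tau> ''D'') n (nats \<rho> ''V'') (reals \<rho> ''K'') (reals \<rho> ''D'') \<and>
            attained n w s (reals \<rho> ''D'')" and fr': "frame improve_round \<tau> \<rho>"
        then have inv: "dijkstra_inv n a p \<epsilon> (reals \<tau> ''D'') n (nats \<rho> ''V'') (reals \<rho> ''K'') (reals \<rho> ''D'')"
          and att: "attained n w s (reals \<rho> ''D'')" by auto
        have settled: "nats \<rho> ''V'' x \<noteq> 0" if "x < n" for x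
          using dijkstra_inv_settled[OF inv that] .
        have cov: "covers n w s (n - r + h) (reals \<rho> ''D'')"
        proof (rule covers_extend[OF adm \<epsilon> _ att _ _ _ _ _ h(3)])
          show "covers n w s (n - r) (reals \<tau> ''D'')" using r by blast
        next
          fix x y assume xy: "x < n" "y < n" "x \<noteq> y"
          have "reals \<rho> ''K'' y \<le> reals \<rho> ''K'' x + (a x y + p x - p y) + \<epsilon> \<and>
              reals \<rho> ''D'' y \<le> reals \<tau> ''D'' x + a x y"
            using inv settled[OF xy(1)] xy(1,2) unfolding dijkstra_inv_def by blast
          then show "reals \<rho> ''K'' y \<le> reals \<rho> ''K'' x + (w (x, y) + p x - p y) + \<epsilon>"
            "reals \<rho> ''D'' y \<le> reals \<tau> ''D'' x + w (x, y)"
            using a[OF xy(1,2)] xy(3) by simp_all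
        qed (use inv in \<open>auto simp: dijkstra_inv_def\<close>)
        \<comment> \<open>If \<open>h\<close> exceeds \<open>r\<close>, the truncated difference is
          0 and the labels cover even more than \<open>n\<close> hops; otherwise both hop counts
          agree.\<close>
        have "covers n w s (n - (r - h)) (reals \<rho> ''D'')"
          using cov \<open>r \<le> n\<close> by (auto simp: covers_def)
        moreover have "nats \<rho> ''rem'' 0 = r" "nats \<rho> ''H'' 0 = h"
          using frame_nats[OF fr', of "''rem''"] frame_nats[OF fr', of "''H''"] r h'
          by (simp_all add: program_defs)
        ultimately show "runs T orc (NAssign ''rem'' (NConst 0) (NSub (nvar ''rem'') (nvar ''H''))) \<rho> 7 (?I m')"
          using att r(3,4) m by (intro runs_straight) auto
      qed (use ld' s \<epsilon> slack a r in auto)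
      then have "runs T orc ?loop_body \<tau> ?B (?I m')" by (rule runs_mono) auto
      with m show "\<exists>m'. m = Suc m' \<and> runs T orc ?loop_body \<tau> ?B (?I m')" by blast
    qed simp
    then show ?thesis
    proof (rule runs_mono)
      fix \<tau>
      assume "(\<exists>m. ?I m \<tau>) \<and> \<not> bval (NLess (NConst 0) (nvar ''rem'')) \<tau>"
      then have "?J n \<tau>" by auto
      then show "outputs_distances n w s \<tau>"
        using distances_if_attained_covers[OF adm s] by (auto simp: outputs_distances_def)
    qed simp
  qed
  let ?H = "\<lambda>\<tau> h. nats \<tau> ''H'' 0 = h \<and> 1 \<le> h \<and> (h = 1 \<or> real h * \<epsilon> < 1) \<and>
    (n < h \<or> 1 \<le> real (Suc h) * \<epsilon>)"
  let ?R = "180 * real n ^ 2 + 77 * real n + 30"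
  let ?M = "2 * real n * \<epsilon> + 1"
  \<comment> \<open>For \<open>h\<close> above \<open>n\<close> the quotient is 0. Otherwise
    \<open>h + 1\<close> is at most \<open>2 * h\<close>, so \<open>1 / h\<close> is at most
    \<open>2 * \<epsilon>\<close>; this is the source of the factor 2.\<close>
  have rounds: "real (?m h) \<le> ?M" if "?H \<tau> h" for \<tau> h
  proof (cases "n < h")
    case True
    then show ?thesis using \<epsilon> by simp
  next
    case False
    then have "1 \<le> real (Suc h) * \<epsilon>" "1 \<le> h" using that by auto
    moreover have "real (Suc h) * \<epsilon> \<le> (2 * real h) * \<epsilon>"
      using \<open>1 \<le> h\<close> \<epsilon> by (intro mult_right_mono) auto
    ultimately have "1 / real h \<le> 2 * \<epsilon>" by (simp add: field_simps)
    from mult_left_mono[OF this, of "real n"] have "real n / real h \<le> 2 * real n * \<epsilon>" by simp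
    moreover have "real (n div h) \<le> real n / real h" by (rule of_nat_div_le_of_nat)
    ultimately show ?thesis by simp
  qed
  have finish: "runs T orc (Seq (NAssign ''rem'' (NConst 0) (nvar ''n'')) ?loop) \<tau>
      (4 + (?M * ?R + 5)) (outputs_distances n w s)"
    if ld: "loaded n a p \<epsilon> \<tau>" and H: "?H \<tau> h" and D: "\<forall>v<n. reals \<tau> ''D'' v = a s v" for \<tau> h
  proof (rule runs_Seq)
    let ?c = "NAssign ''rem'' (NConst 0) (nvar ''n'')"
    show "runs T orc ?c \<tau> 4 (\<lambda>\<rho>. \<rho> = effect ?c \<tau>)" by (rule runs_straight) auto
    fix \<rho> assume \<rho>: "\<rho> = effect ?c \<tau>" and fr: "frame ?c \<tau> \<rho>"
    have "runs T orc ?loop \<rho> (real (?m h) * (?B + 5) + 5) (outputs_distances n w s)"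
    proof (rule loop)
      show "loaded n a p \<epsilon> \<rho>" using loaded_frame[OF fr _ _ ld] by simp
      have "\<exists>q. walk n s q v \<and> reals \<rho> ''D'' v = cost w q" if v: "v < n" for v
      proof (cases "v = s")
        case True
        then show ?thesis
          using D v s \<rho> a[OF s s] by (intro exI[of _ "[]"]) (simp add: walk_Nil_iff)
      next
        case False
        then have "walk n s ([] @ [(s, v)]) v"
          using v s unfolding walk_snoc_iff by (simp add: walk_Nil_iff)
        then show ?thesis
          using D v False \<rho> a[OF s v] by (intro exI[of _ "[(s, v)]"]) simp
      qed
      moreover have "reals \<rho> ''D'' v \<le> cost w []" if "walk n s [] v" for v
        using that D s \<rho> a[OF s s] by (simp add: walk_Nil_iff)
      ultimately show "?J 0 \<rho>" by (auto simp: attained_def covers_def)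
      show "nats \<rho> ''rem'' 0 = n" using ld \<rho> by (simp add: loaded_def)
      show "nats \<rho> ''H'' 0 = h" "1 \<le> h" "h = 1 \<or> real h * \<epsilon> < 1" using H \<rho> by auto
    qed
    then show "runs T orc ?loop \<rho> (?M * ?R + 5) (outputs_distances n w s)"
    proof (rule runs_mono)
      have "real (?m h) * ?R \<le> ?M * ?R"
        using rounds[OF H] by (intro mult_right_mono) auto
      moreover have "?B + 5 = ?R" by simp
      ultimately show "real (?m h) * (?B + 5) + 5 \<le> ?M * ?R + 5"
        by (simp only: add_le_cancel_right)
    qed
  qed
  have "runs T orc sssp ?in
      ((40 * real n + 9) + ((60 * real n + 30) + ((T n \<epsilon> + 5) + ((40 * real n + 9) + (4 + (?M * ?R + 5))))))
      (outputs_distances n w s)"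
    unfolding sssp_def
  proof (rule runs_Seq[OF runs_row_offsets])
    show "nats ?in ''n'' 0 = n" "nats ?in ''R'' 0 = 0" by (simp_all add: input_store_def)
    fix \<sigma>1 assume R: "\<forall>j\<le>n. nats \<sigma>1 ''R'' j = j * n" and fr1: "frame row_offsets ?in \<sigma>1"
    have 1: "nats \<sigma>1 ''n'' 0 = n" "nats \<sigma>1 ''s'' 0 = s" "reals \<sigma>1 ''W'' = ?W" "reals \<sigma>1 ''eps'' 0 = \<epsilon>"
      "reals \<sigma>1 ''p'' = (\<lambda>_. 0)"
      using frame_nats[OF fr1] frame_reals[OF fr1] by (simp_all add: row_offsets_def input_store_def)
    let ?orc = "CallOracle ''p'' (nvar ''n'') ''W'' (rvar ''eps'')"
    let ?rest = "Seq (NAssign ''rem'' (NConst 0) (nvar ''n'')) ?loop"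
    show "runs T orc (Seq hop_count (Seq ?orc (Seq init_labels ?rest))) \<sigma>1
        ((60 * real n + 30) + ((T n \<epsilon> + 5) + ((40 * real n + 9) + (4 + (?M * ?R + 5))))) (outputs_distances n w s)"
    proof (rule runs_Seq[OF runs_hop_count[OF 1(1) 1(4)]])
      fix \<sigma>2 assume "\<exists>h. ?H \<sigma>2 h" and fr2: "frame hop_count \<sigma>1 \<sigma>2"
      then obtain h where H: "?H \<sigma>2 h" by blast
      have 2: "nats \<sigma>2 ''n'' 0 = n" "nats \<sigma>2 ''s'' 0 = s" "reals \<sigma>2 ''W'' = ?W" "reals \<sigma>2 ''eps'' 0 = \<epsilon>"
        "reals \<sigma>2 ''p'' = (\<lambda>_. 0)" "nats \<sigma>2 ''R'' = nats \<sigma>1 ''R''"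
        using frame_nats[OF fr2] frame_reals[OF fr2] 1 by (simp_all add: hop_count_def)
      show "runs T orc (Seq ?orc (Seq init_labels ?rest)) \<sigma>2
          ((T n \<epsilon> + 5) + ((40 * real n + 9) + (4 + (?M * ?R + 5)))) (outputs_distances n w s)"
      proof (rule runs_Seq)
        show "runs T orc ?orc \<sigma>2 (T n \<epsilon> + 5) (\<lambda>\<tau>. reals \<tau> ''p'' = p)"
          using exec.CallOracle[of n "nvar ''n''" \<sigma>2 \<epsilon> "rvar ''eps''" T orc "''p''" "''W''"] 2
          by (force simp: runs_def p_def)
        fix \<sigma>3 assume p: "reals \<sigma>3 ''p'' = p" and fr3: "frame ?orc \<sigma>2 \<sigma>3"
        have ld: "loaded n a p \<epsilon> \<sigma>3"
          using p 2 R frame_nats[OF fr3] frame_reals[OF fr3] by (simp add: loaded_def a_def)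
        have 3: "nats \<sigma>3 = nats \<sigma>2" "reals \<sigma>3 ''W'' = ?W"
          using frame_nats[OF fr3] frame_reals[OF fr3] 2 by (auto simp: fun_eq_iff)
        show "runs T orc (Seq init_labels ?rest) \<sigma>3
            ((40 * real n + 9) + (4 + (?M * ?R + 5))) (outputs_distances n w s)"
        proof (rule runs_Seq[OF runs_init_labels])
          show "nats \<sigma>3 ''n'' 0 = n" "nats \<sigma>3 ''s'' 0 = s" "s < n"
            "\<And>j. j \<le> n \<Longrightarrow> nats \<sigma>3 ''R'' j = j * n"
            using 2 3 R s by auto
          fix \<sigma>4 assume D: "\<forall>v<n. reals \<sigma>4 ''D'' v = reals \<sigma>3 ''W'' (s * n + v)"
            and fr4: "frame init_labels \<sigma>3 \<sigma>4"
          show "runs T orc ?rest \<sigma>4 (4 + (?M * ?R + 5)) (outputs_distances n w s)"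
          proof (rule finish)
            show "loaded n a p \<epsilon> \<sigma>4"
              using loaded_frame[OF fr4 _ _ ld] by (simp add: init_labels_def)
            show "?H \<sigma>4 h"
              using H frame_nats[OF fr4, of "''H''"] 3 by (simp add: init_labels_def)
            show "\<forall>v<n. reals \<sigma>4 ''D'' v = a s v" using D 3 by (simp add: a_def)
          qed
        qed
      qed
    qed
  qed
  then show ?thesis
  proof (rule runs_mono)
    have "1 \<le> real n" using s by simp
    then have n1: "real n \<le> real n ^ 2" "1 \<le> real n ^ 2"
      by (simp_all add: self_le_power)
    \<comment> \<open>Here 287 is 180 + 77 + 30, and 574 is its double. The terms outside the loop,
      \<open>140 * n + 62\<close>, raise the quadratic coefficient to 489.\<close>
    have "?M * ?R \<le> ?M * (287 * real n ^ 2)"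
    proof (rule mult_left_mono)
      show "?R \<le> 287 * real n ^ 2" using n1 by linarith
    qed (use \<epsilon> in simp)
    also have "\<dots> = 287 * real n ^ 2 + 574 * (real n ^ 3 * \<epsilon>)"
      by (simp add: algebra_simps power2_eq_square power3_eq_cube)
    finally show "(40 * real n + 9) + ((60 * real n + 30) + ((T n \<epsilon> + 5) + ((40 * real n + 9) +
        (4 + (?M * ?R + 5))))) \<le> T n \<epsilon> + 489 * real n ^ 2 + 574 * (real n ^ 3 * \<epsilon>)"
      using n1 by linarith
  qed
qed

text \<open>The bound of \<open>runs_sssp\<close> has no logarithm. From \<open>n = 2\<close> on,
  \<open>2 * ln n\<close> is at least 1, so the factor can be inserted at the price of doubling the
  constants; 1148 is twice 574 and exceeds twice 489.\<close>

theorem theorem7p1: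
  shows "\<exists>(prog :: com) (C :: real).
    \<forall>(T :: nat \<Rightarrow> real \<Rightarrow> real) (orc :: dual_oracle_fun). dual_oracle T orc \<longrightarrow>
      (\<forall>(n :: nat) (w :: (nat \<times> nat) weight_fun) (s :: nat) (\<epsilon> :: real).
         admissible n w \<and> s < n \<and> 0 < \<epsilon> \<longrightarrow>
         (\<exists>t \<sigma>. exec T orc prog (input_store n w s \<epsilon>) t \<sigma> \<and>
                outputs_distances n w s \<sigma> \<and>
                (2 \<le> n \<longrightarrow>
                   t \<le> T n \<epsilon> + C * (real n ^ 3 * \<epsilon> * ln (real n) + real n ^ 2 * ln (real n)))))"
proof (rule exI[of _ sssp], rule exI[of _ "1148 :: real"], intro allI impI)
  fix T :: "nat \<Rightarrow> real \<Rightarrow> real" and orc n w s and \<epsilon> :: real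
  assume orc: "dual_oracle T orc" and A: "admissible n w \<and> s < n \<and> 0 < \<epsilon>"
  then obtain t \<sigma> where t: "exec T orc sssp (input_store n w s \<epsilon>) t \<sigma>"
      "t \<le> T n \<epsilon> + 489 * real n ^ 2 + 574 * (real n ^ 3 * \<epsilon>)" "outputs_distances n w s \<sigma>"
    using runs_sssp[OF orc, of n w s \<epsilon>] unfolding runs_def by blast
  have "t \<le> T n \<epsilon> + 1148 * (real n ^ 3 * \<epsilon> * ln (real n) + real n ^ 2 * ln (real n))" if "2 \<le> n"
  proof -
    \<comment> \<open>As \<open>exp 1\<close> is at most 3, hence below 4, taking logarithms gives
      \<open>1 \<le> 2 * ln 2\<close>.\<close>
    have "exp 1 \<le> (2::real) ^ 2" using exp_le by simp
    then have "1 \<le> ln ((2::real) ^ 2)" by (subst ln_ge_iff) auto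
    then have "1 \<le> 2 * ln (2::real)" by (simp only: ln_realpow)
    also have "\<dots> \<le> 2 * ln (real n)" using that by simp
    finally have L: "1 \<le> 2 * ln (real n)" .
    have le: "x \<le> 2 * (x * ln (real n))" if "0 \<le> x" for x :: real
      using mult_left_mono[OF L that] by simp
    have "real n ^ 3 * \<epsilon> \<le> 2 * (real n ^ 3 * \<epsilon> * ln (real n))"
      using A by (intro le) simp
    moreover have "real n ^ 2 \<le> 2 * (real n ^ 2 * ln (real n))" by (intro le) simp
    moreover have "0 \<le> real n ^ 2" by simp
    ultimately show ?thesis using t(2) by argo
  qed
  with t show "\<exists>t \<sigma>. exec T orc sssp (input_store n w s \<epsilon>) t \<sigma> \<and> outputs_distances n w s \<sigma> \<and>
      (2 \<le> n \<longrightarrow> t \<le> T n \<epsilon> + 1148 * (real n ^ 3 * \<epsilon> * ln (real n) + real n ^ 2 * ln (real n)))"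
    by blast
qed

end
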